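(* Up to isomorphism, the $5$-dimensional Lie algebras with nontrivial center admitting an $\eta$-Einstein Sasakian structure are the following, described by $(de^1,\dots,de^5)$ for a basis $e^1,\dots,e^5$ of the dual space: - $\mathfrak{g}_1=(0,0,0,0,e^{12}+e^{34})\simeq\mathfrak{h}_5$; - $\mathfrak{g}_3=(0,-e^{13},e^{12},0,e^{14}+e^{23})\simeq\mathbb{R}\ltimes(\mathfrak{h}_3\times\mathbb{R})$; - $\mathfrak{g}_4=(0,-e^{12},0,-e^{34},e^{12}+e^{34})\simeq\mathfrak{aff}(\mathbb{R})\times\mathfrak{aff}(\mathbb{R})\times\mathbb{R}$; - $\mathfrak{g}_5=(\frac12e^{14},\frac12e^{24},-e^{12}+e^{34},0,e^{12}-e^{34})\simeq\mathbb{R}\times(\mathbb{R}\ltimes\mathfrak{h}_3)$; - $\mathfrak{g}_7^\delta=(\frac\delta2e^{14}+e^{24},-e^{14}+\frac\delta2e^{24},-e^{12}+\delta e^{34},0,e^{12}-\delta e^{34})\simeq\mathbb{R}\times(\mathbb{R}\ltimes\mathfrak{h}_3)$, $\delta>0$.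
   Context: All Lie algebras are real; $d$ is the Chevalley–Eilenberg differential, so $d\eta(X,Y)=-\eta([X,Y])$ for a $1$-form $\eta$; $e^{ij}=e^i\wedge e^j$. An almost contact metric Lie algebra $(\mathfrak{g},\varphi,\xi,\eta,g)$ is an odd-dimensional Lie algebra $\mathfrak{g}$ with $\varphi\in\mathrm{End}(\mathfrak{g})$, $\xi\in\mathfrak{g}$, $\eta\in\mathfrak{g}^*$ and a positive-definite inner product $g$ such that $\varphi^2=-I+\eta\otimes\xi$, $\eta(\xi)=1$, $g(\varphi X,\varphi Y)=g(X,Y)-\eta(X)\eta(Y)$. Its fundamental $2$-form is $\Phi(X,Y)=g(X,\varphi Y)$, and $$N_\varphi(X,Y)=[\varphi X,\varphi Y]+\varphi^2[X,Y]-\varphi[X,\varphi Y]-\varphi[\varphi X,Y]+d\eta(X,Y)\xi .$$ The structure is Sasakian if $N_\varphi=0$ and $d\eta=2\Phi$. It is $\eta$-Einstein if the Ricci tensor of $g$ (viewed as a left-invariant metric on a Lie group with Lie algebra $\mathfrak{g}$) satisfies $\mathrm{Ric}=\lambda g+\mu\,\eta\otimes\eta$ for some $\lambda,\mu\in\mathbb{R}$. $\mathfrak{h}_3$, $\mathfrak{h}_5$ are the $3$- and $5$-dimensional Heisenberg Lie algebras and $\mathfrak{aff}(\mathbb{R})$ is the non-abelian $2$-dimensional Lie algebra. *)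

theory Defs
  imports "HOL-Analysis.Analysis"
begin

section \<open>Real Lie algebras\<close>

text \<open>A real Lie algebra is a real vector space (a type of class \<open>real_vector\<close>) with a bracket.\<close>

definition lie_algebra :: "('a::real_vector \<Rightarrow> 'a \<Rightarrow> 'a) \<Rightarrow> bool" where
  "lie_algebra br \<longleftrightarrow>
     bilinear br \<and> (\<forall>x. br x x = 0) \<and>
     (\<forall>x y z. br x (br y z) + br y (br z x) + br z (br x y) = 0)"

definition lie_center :: "('a::real_vector \<Rightarrow> 'a \<Rightarrow> 'a) \<Rightarrow> 'a set" where
  "lie_center br = {z. \<forall>x. br z x = 0}"

definition lie_isomorphic ::
    "('a::real_vector \<Rightarrow> 'a \<Rightarrow> 'a) \<Rightarrow> ('b::real_vector \<Rightarrow> 'b \<Rightarrow> 'b) \<Rightarrow> bool" (infix "\<simeq>\<^sub>L" 50) where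
  "br \<simeq>\<^sub>L br' \<longleftrightarrow> (\<exists>f. linear f \<and> bij f \<and> (\<forall>x y. f (br x y) = br' (f x) (f y)))"

definition ce_d :: "('a::real_vector \<Rightarrow> 'a \<Rightarrow> 'a) \<Rightarrow> ('a \<Rightarrow> real) \<Rightarrow> 'a \<Rightarrow> 'a \<Rightarrow> real" where
  "ce_d br \<eta> x y = - \<eta> (br x y)"

definition derivation :: "('a::real_vector \<Rightarrow> 'a \<Rightarrow> 'a) \<Rightarrow> ('a \<Rightarrow> 'a) \<Rightarrow> bool" where
  "derivation br D \<longleftrightarrow> linear D \<and> (\<forall>x y. D (br x y) = br (D x) y + br x (D y))"

definition abelian_lie :: "'a::real_vector \<Rightarrow> 'a \<Rightarrow> 'a" where
  "abelian_lie x y = 0"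

definition prod_lie ::
    "('a::real_vector \<Rightarrow> 'a \<Rightarrow> 'a) \<Rightarrow> ('b::real_vector \<Rightarrow> 'b \<Rightarrow> 'b) \<Rightarrow> 'a \<times> 'b \<Rightarrow> 'a \<times> 'b \<Rightarrow> 'a \<times> 'b" where
  "prod_lie br br' x y = (br (fst x) (fst y), br' (snd x) (snd y))"

text \<open>The semidirect product of \<open>\<real>\<close> and a Lie algebra, where \<open>1 \<in> \<real>\<close> acts by the derivation \<open>D\<close>.\<close>

definition semidirect_R ::
    "('a \<Rightarrow> 'a) \<Rightarrow> ('a::real_vector \<Rightarrow> 'a \<Rightarrow> 'a) \<Rightarrow> real \<times> 'a \<Rightarrow> real \<times> 'a \<Rightarrow> real \<times> 'a" where
  "semidirect_R D br x y =
     (0, fst x *\<^sub>R D (snd y) - fst y *\<^sub>R D (snd x) + br (snd x) (snd y))"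

text \<open>The Heisenberg Lie algebra on \<open>V \<oplus> V \<oplus> \<real>\<close>, of dimension \<open>2 dim V + 1\<close>:
  the nonzero brackets of standard basis vectors are \<open>[x\<^sub>i, y\<^sub>i] = z\<close>.\<close>

definition heisenberg ::
    "'v::euclidean_space \<times> 'v \<times> real \<Rightarrow> 'v \<times> 'v \<times> real \<Rightarrow> 'v \<times> 'v \<times> real" where
  "heisenberg = (\<lambda>(p, q, t) (p', q', t'). (0, 0, p \<bullet> q' - q \<bullet> p'))"

abbreviation "\<hh>\<^sub>3 \<equiv> (heisenberg :: real \<times> real \<times> real \<Rightarrow> _)"

abbreviation "\<hh>\<^sub>5 \<equiv> (heisenberg :: (real^2) \<times> (real^2) \<times> real \<Rightarrow> _)"

abbreviation "lie_R \<equiv> (abelian_lie :: real \<Rightarrow> real \<Rightarrow> real)"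

definition aff_R :: "real \<times> real \<Rightarrow> real \<times> real \<Rightarrow> real \<times> real" where
  "aff_R = (\<lambda>(a, b) (a', b'). (0, a * b' - a' * b))"


section \<open>The Ricci tensor of a left-invariant metric\<close>

definition inner_product_form :: "('a::real_vector \<Rightarrow> 'a \<Rightarrow> real) \<Rightarrow> bool" where
  "inner_product_form g \<longleftrightarrow>
     bilinear g \<and> (\<forall>x y. g x y = g y x) \<and> (\<forall>x. x \<noteq> 0 \<longrightarrow> g x x > 0)"

text \<open>Left-invariant tensors on the Lie group are identified with tensors on its Lie algebra. For
  left-invariant \<open>x, y, z\<close> the function \<open>g y z\<close> is constant, so compatibility of the connection with
  the metric reads \<open>g (\<nabla>\<^sub>x y) z + g y (\<nabla>\<^sub>x z) = 0\<close>.\<close>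

definition is_levi_civita ::
    "('a::real_vector \<Rightarrow> 'a \<Rightarrow> 'a) \<Rightarrow> ('a \<Rightarrow> 'a \<Rightarrow> real) \<Rightarrow> ('a \<Rightarrow> 'a \<Rightarrow> 'a) \<Rightarrow> bool" where
  "is_levi_civita br g nab \<longleftrightarrow>
     bilinear nab \<and>
     (\<forall>x y. nab x y - nab y x = br x y) \<and>
     (\<forall>x y z. g (nab x y) z + g y (nab x z) = 0)"

definition levi_civita ::
    "('a::real_vector \<Rightarrow> 'a \<Rightarrow> 'a) \<Rightarrow> ('a \<Rightarrow> 'a \<Rightarrow> real) \<Rightarrow> 'a \<Rightarrow> 'a \<Rightarrow> 'a" where
  "levi_civita br g = (THE nab. is_levi_civita br g nab)"

definition curvature ::
    "('a::real_vector \<Rightarrow> 'a \<Rightarrow> 'a) \<Rightarrow> ('a \<Rightarrow> 'a \<Rightarrow> real) \<Rightarrow> 'a \<Rightarrow> 'a \<Rightarrow> 'a \<Rightarrow> 'a" where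
  "curvature br g x y z =
     levi_civita br g x (levi_civita br g y z)
     - levi_civita br g y (levi_civita br g x z)
     - levi_civita br g (br x y) z"

text \<open>The trace of an endomorphism of a finite-dimensional space; it does not depend on the basis,
  see \<open>lin_trace_eq\<close> below.\<close>

definition lin_trace :: "('a::real_vector \<Rightarrow> 'a) \<Rightarrow> real" where
  "lin_trace f = (let B = (SOME B. independent B \<and> span B = UNIV) in
                   \<Sum>b\<in>B. representation B (f b) b)"

definition ricci ::
    "('a::real_vector \<Rightarrow> 'a \<Rightarrow> 'a) \<Rightarrow> ('a \<Rightarrow> 'a \<Rightarrow> real) \<Rightarrow> 'a \<Rightarrow> 'a \<Rightarrow> real" where
  "ricci br g y z = lin_trace (\<lambda>x. curvature br g x y z)"


section \<open>Sasakian Lie algebras\<close>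

definition almost_contact_metric ::
    "('a::real_vector \<Rightarrow> 'a \<Rightarrow> 'a) \<Rightarrow> ('a \<Rightarrow> 'a) \<Rightarrow> 'a \<Rightarrow> ('a \<Rightarrow> real) \<Rightarrow> ('a \<Rightarrow> 'a \<Rightarrow> real) \<Rightarrow> bool" where
  "almost_contact_metric br \<phi> \<xi> \<eta> g \<longleftrightarrow>
     lie_algebra br \<and> odd (dim (UNIV :: 'a set)) \<and>
     linear \<phi> \<and> linear \<eta> \<and> inner_product_form g \<and>
     (\<forall>x. \<phi> (\<phi> x) = - x + \<eta> x *\<^sub>R \<xi>) \<and>
     \<eta> \<xi> = 1 \<and>
     (\<forall>x y. g (\<phi> x) (\<phi> y) = g x y - \<eta> x * \<eta> y)"

definition fundamental_form ::
    "('a \<Rightarrow> 'a) \<Rightarrow> ('a \<Rightarrow> 'a \<Rightarrow> real) \<Rightarrow> 'a \<Rightarrow> 'a \<Rightarrow> real" where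
  "fundamental_form \<phi> g x y = g x (\<phi> y)"

definition normality_tensor ::
    "('a::real_vector \<Rightarrow> 'a \<Rightarrow> 'a) \<Rightarrow> ('a \<Rightarrow> 'a) \<Rightarrow> 'a \<Rightarrow> ('a \<Rightarrow> real) \<Rightarrow> 'a \<Rightarrow> 'a \<Rightarrow> 'a" where
  "normality_tensor br \<phi> \<xi> \<eta> x y =
     br (\<phi> x) (\<phi> y) + \<phi> (\<phi> (br x y)) - \<phi> (br x (\<phi> y)) - \<phi> (br (\<phi> x) y) + ce_d br \<eta> x y *\<^sub>R \<xi>"

definition sasakian ::
    "('a::real_vector \<Rightarrow> 'a \<Rightarrow> 'a) \<Rightarrow> ('a \<Rightarrow> 'a) \<Rightarrow> 'a \<Rightarrow> ('a \<Rightarrow> real) \<Rightarrow> ('a \<Rightarrow> 'a \<Rightarrow> real) \<Rightarrow> bool" where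
  "sasakian br \<phi> \<xi> \<eta> g \<longleftrightarrow>
     almost_contact_metric br \<phi> \<xi> \<eta> g \<and>
     (\<forall>x y. normality_tensor br \<phi> \<xi> \<eta> x y = 0) \<and>
     (\<forall>x y. ce_d br \<eta> x y = 2 * fundamental_form \<phi> g x y)"

definition eta_einstein ::
    "('a::real_vector \<Rightarrow> 'a \<Rightarrow> 'a) \<Rightarrow> ('a \<Rightarrow> real) \<Rightarrow> ('a \<Rightarrow> 'a \<Rightarrow> real) \<Rightarrow> bool" where
  "eta_einstein br \<eta> g \<longleftrightarrow>
     (\<exists>l m. \<forall>x y. ricci br g x y = l * g x y + m * (\<eta> x * \<eta> y))"


section \<open>The Lie algebras of the classification\<close>

text \<open>The algebras live on \<open>\<real>\<^sup>5\<close>, with \<open>e\<^sup>1, \<dots>, e\<^sup>5\<close> the coordinate functions. Since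
  \<open>de\<^sup>k(x, y) = -e\<^sup>k([x, y])\<close>, the bracket is minus the vector \<open>(de\<^sup>1, \<dots>, de\<^sup>5)(x, y)\<close>;
  see the \<open>ce_d\<close> lemmas below.\<close>

definition e2 :: "5 \<Rightarrow> 5 \<Rightarrow> real^5 \<Rightarrow> real^5 \<Rightarrow> real" where
  "e2 i j x y = x $ i * y $ j - x $ j * y $ i"

definition \<gg>\<^sub>1 :: "real^5 \<Rightarrow> real^5 \<Rightarrow> real^5" where
  "\<gg>\<^sub>1 x y = - vector [0, 0, 0, 0, e2 1 2 x y + e2 3 4 x y]"

definition \<gg>\<^sub>3 :: "real^5 \<Rightarrow> real^5 \<Rightarrow> real^5" where
  "\<gg>\<^sub>3 x y = - vector [0, - e2 1 3 x y, e2 1 2 x y, 0, e2 1 4 x y + e2 2 3 x y]"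

definition \<gg>\<^sub>4 :: "real^5 \<Rightarrow> real^5 \<Rightarrow> real^5" where
  "\<gg>\<^sub>4 x y = - vector [0, - e2 1 2 x y, 0, - e2 3 4 x y, e2 1 2 x y + e2 3 4 x y]"

definition \<gg>\<^sub>5 :: "real^5 \<Rightarrow> real^5 \<Rightarrow> real^5" where
  "\<gg>\<^sub>5 x y = - vector [1/2 * e2 1 4 x y, 1/2 * e2 2 4 x y, - e2 1 2 x y + e2 3 4 x y, 0,
                     e2 1 2 x y - e2 3 4 x y]"

definition \<gg>\<^sub>7 :: "real \<Rightarrow> real^5 \<Rightarrow> real^5 \<Rightarrow> real^5" where
  "\<gg>\<^sub>7 \<delta> x y = - vector [\<delta>/2 * e2 1 4 x y + e2 2 4 x y, - e2 1 4 x y + \<delta>/2 * e2 2 4 x y,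
                       - e2 1 2 x y + \<delta> * e2 3 4 x y, 0, e2 1 2 x y - \<delta> * e2 3 4 x y]"


section \<open>Well-definedness of the notions above\<close>

lemma vector_5:
  "(vector [a, b, c, d, e] :: real^5) $ 1 = a"
  "(vector [a, b, c, d, e] :: real^5) $ 2 = b"
  "(vector [a, b, c, d, e] :: real^5) $ 3 = c"
  "(vector [a, b, c, d, e] :: real^5) $ 4 = d"
  "(vector [a, b, c, d, e] :: real^5) $ 5 = e"
  by (simp_all add: vector_def)

lemma exhaust_5: "(i::5) = 1 \<or> i = 2 \<or> i = 3 \<or> i = 4 \<or> i = 5"
proof (induct i)
  case (of_int z)
  then have "0 \<le> z" "z < 5" by simp_all
  then have "z = 0 \<or> z = 1 \<or> z = 2 \<or> z = 3 \<or> z = 4" by arith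
  then show ?case by auto
qed

lemma forall_5: "(\<forall>i::5. P i) \<longleftrightarrow> P 1 \<and> P 2 \<and> P 3 \<and> P 4 \<and> P 5"
  by (metis exhaust_5)

lemma ce_d_g1:
  "ce_d \<gg>\<^sub>1 (\<lambda>v. v $ 1) x y = 0" "ce_d \<gg>\<^sub>1 (\<lambda>v. v $ 2) x y = 0"
  "ce_d \<gg>\<^sub>1 (\<lambda>v. v $ 3) x y = 0" "ce_d \<gg>\<^sub>1 (\<lambda>v. v $ 4) x y = 0"
  "ce_d \<gg>\<^sub>1 (\<lambda>v. v $ 5) x y = e2 1 2 x y + e2 3 4 x y"
  by (simp_all add: ce_d_def \<gg>\<^sub>1_def vector_5)

lemma ce_d_g3:
  "ce_d \<gg>\<^sub>3 (\<lambda>v. v $ 1) x y = 0" "ce_d \<gg>\<^sub>3 (\<lambda>v. v $ 2) x y = - e2 1 3 x y"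
  "ce_d \<gg>\<^sub>3 (\<lambda>v. v $ 3) x y = e2 1 2 x y" "ce_d \<gg>\<^sub>3 (\<lambda>v. v $ 4) x y = 0"
  "ce_d \<gg>\<^sub>3 (\<lambda>v. v $ 5) x y = e2 1 4 x y + e2 2 3 x y"
  by (simp_all add: ce_d_def \<gg>\<^sub>3_def vector_5)

lemma ce_d_g4:
  "ce_d \<gg>\<^sub>4 (\<lambda>v. v $ 1) x y = 0" "ce_d \<gg>\<^sub>4 (\<lambda>v. v $ 2) x y = - e2 1 2 x y"
  "ce_d \<gg>\<^sub>4 (\<lambda>v. v $ 3) x y = 0" "ce_d \<gg>\<^sub>4 (\<lambda>v. v $ 4) x y = - e2 3 4 x y"
  "ce_d \<gg>\<^sub>4 (\<lambda>v. v $ 5) x y = e2 1 2 x y + e2 3 4 x y"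
  by (simp_all add: ce_d_def \<gg>\<^sub>4_def vector_5)

lemma ce_d_g5:
  "ce_d \<gg>\<^sub>5 (\<lambda>v. v $ 1) x y = 1/2 * e2 1 4 x y" "ce_d \<gg>\<^sub>5 (\<lambda>v. v $ 2) x y = 1/2 * e2 2 4 x y"
  "ce_d \<gg>\<^sub>5 (\<lambda>v. v $ 3) x y = - e2 1 2 x y + e2 3 4 x y" "ce_d \<gg>\<^sub>5 (\<lambda>v. v $ 4) x y = 0"
  "ce_d \<gg>\<^sub>5 (\<lambda>v. v $ 5) x y = e2 1 2 x y - e2 3 4 x y"
  by (simp_all add: ce_d_def \<gg>\<^sub>5_def vector_5)

lemma ce_d_g7:
  "ce_d (\<gg>\<^sub>7 \<delta>) (\<lambda>v. v $ 1) x y = \<delta>/2 * e2 1 4 x y + e2 2 4 x y"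
  "ce_d (\<gg>\<^sub>7 \<delta>) (\<lambda>v. v $ 2) x y = - e2 1 4 x y + \<delta>/2 * e2 2 4 x y"
  "ce_d (\<gg>\<^sub>7 \<delta>) (\<lambda>v. v $ 3) x y = - e2 1 2 x y + \<delta> * e2 3 4 x y"
  "ce_d (\<gg>\<^sub>7 \<delta>) (\<lambda>v. v $ 4) x y = 0"
  "ce_d (\<gg>\<^sub>7 \<delta>) (\<lambda>v. v $ 5) x y = e2 1 2 x y - \<delta> * e2 3 4 x y"
  by (simp_all add: ce_d_def \<gg>\<^sub>7_def vector_5)

lemmas lie_5_simps = lie_algebra_def bilinear_def linear_iff vec_eq_iff forall_5 vector_5 e2_def

lemma lie_algebra_g1: "lie_algebra \<gg>\<^sub>1"
  by (simp add: lie_5_simps \<gg>\<^sub>1_def algebra_simps)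

lemma lie_algebra_g3: "lie_algebra \<gg>\<^sub>3"
  by (simp add: lie_5_simps \<gg>\<^sub>3_def algebra_simps)

lemma lie_algebra_g4: "lie_algebra \<gg>\<^sub>4"
  by (simp add: lie_5_simps \<gg>\<^sub>4_def algebra_simps)

lemma lie_algebra_g5: "lie_algebra \<gg>\<^sub>5"
  by (simp add: lie_5_simps \<gg>\<^sub>5_def field_simps)

lemma lie_algebra_g7: "lie_algebra (\<gg>\<^sub>7 \<delta>)"
  by (simp add: lie_5_simps \<gg>\<^sub>7_def field_simps)

lemma finite_basis_if_dim:
  assumes "dim (UNIV :: 'a::real_vector set) > 0" "independent (B :: 'a set)" "span B = UNIV"
  shows "finite B"
  using assms real_vector.dim_eq_card[of B UNIV] by (metis card.infinite less_numeral_extra(3) real_vector.span_UNIV)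

lemma lin_trace_eq:
  fixes f :: "'a::real_vector \<Rightarrow> 'a"
  assumes "dim (UNIV :: 'a set) > 0" "linear f" "independent B" "span B = UNIV"
  shows "lin_trace f = (\<Sum>b\<in>B. representation B (f b) b)"
proof -
  define C where "C = (SOME B :: 'a set. independent B \<and> span B = UNIV)"
  have C: "independent C \<and> span C = UNIV"
    unfolding C_def by (rule someI[of _ B]) (use assms in auto)
  have fin: "finite B" "finite C"
    using finite_basis_if_dim[OF assms(1)] assms C by auto
  have lr: "linear (\<lambda>x. representation D x b)" if "independent D" "span D = UNIV" for D :: "'a set" and b
    using that by (intro linearI) (simp_all add: real_vector.representation_add real_vector.representation_scale)
  have expand: "x = (\<Sum>d\<in>D. representation D x d *\<^sub>R d)" if "independent D" "span D = UNIV" "finite D"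
    for D :: "'a set" and x
    using real_vector.sum_representation_eq[OF that(1), of x D] that by simp
  have "representation B (f b) b = (\<Sum>c\<in>C. representation B c b * representation C (f b) c)"
    for b
    by (subst expand[of C "f b"]; use C fin assms in
        \<open>simp add: linear_sum[OF lr] linear_cmul[OF lr] mult.commute\<close>)
  then have "(\<Sum>b\<in>B. representation B (f b) b)
      = (\<Sum>c\<in>C. \<Sum>b\<in>B. representation B c b * representation C (f b) c)"
    by (simp add: sum.swap[of _ C])
  also have "\<dots> = (\<Sum>c\<in>C. representation C (f c) c)"
  proof (rule sum.cong[OF refl])
    fix c assume "c \<in> C"
    have lin: "linear (\<lambda>x. representation C (f x) c)"
      using linear_compose[OF assms(2) lr[of C c]] C by (simp add: o_def)
    have "representation C (f c) c = representation C (f (\<Sum>b\<in>B. representation B c b *\<^sub>R b)) c"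
      using expand[of B c] assms fin by simp
    also have "\<dots> = (\<Sum>b\<in>B. representation B c b * representation C (f b) c)"
      by (simp add: linear_sum[OF lin] linear_cmul[OF lin])
    finally show "(\<Sum>b\<in>B. representation B c b * representation C (f b) c) = representation C (f c) c" ..
  qed
  finally show ?thesis
    unfolding lin_trace_def C_def[symmetric] Let_def ..
qed

lemma inner_product_form_riesz:
  fixes g :: "'a::real_vector \<Rightarrow> 'a \<Rightarrow> real"
  assumes "dim (UNIV :: 'a set) > 0" "inner_product_form g" "linear f"
  shows "\<exists>!x. \<forall>y. g x y = f y"
proof -
  obtain B :: "'a set" where B: "independent B" "span B = UNIV"
    using real_vector.basis_exists[of UNIV] by (metis real_vector.span_UNIV real_vector.span_subspace top_greatest UNIV_I subsetI subset_antisym)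
  have fin: "finite B"
    using finite_basis_if_dim[OF assms(1) B] .
  interpret fd: finite_dimensional_vector_space "(*\<^sub>R) :: real \<Rightarrow> 'a \<Rightarrow> 'a" B
    using B fin by unfold_locales (simp_all add: dependent_raw_def span_raw_def)
  have gl: "linear (\<lambda>x. g x y)" and gr: "linear (g x)" for x y
    using assms(2) by (auto simp: inner_product_form_def bilinear_def)
  have zero: "x = 0" if "\<forall>b\<in>B. g x b = 0" for x
  proof -
    have "g x y = 0" for y
      using linear_eq_0_on_span[OF gr[of x], of B y] that B by auto
    then show ?thesis
      using assms(2) unfolding inner_product_form_def by (metis less_irrefl)
  qed
  define T where "T x = (\<Sum>b\<in>B. g x b *\<^sub>R b)" for x
  have linT: "linear T"
    unfolding T_def
    by (intro linearI) (simp_all add: linear_add[OF gl] linear_cmul[OF gl] scaleR_add_left sum.distrib scaleR_sum_right)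
  have "inj T"
  proof (subst linear_injective_0[OF linT], intro allI impI)
    fix x assume "T x = 0"
    then have "\<forall>b\<in>B. g x b = 0"
      using real_vector.independentD[OF B(1) fin subset_refl, of "g x"] unfolding T_def by blast
    then show "x = 0" by (rule zero)
  qed
  then have "surj T"
    using fd.linear_inj_imp_surj linT by (simp add: linear_def module_hom_iff_linear real_scaleR_def)
  then obtain x where x: "T x = (\<Sum>b\<in>B. f b *\<^sub>R b)"
    by (metis surjE)
  have "(\<Sum>b\<in>B. (g x b - f b) *\<^sub>R b) = 0"
    using x unfolding T_def by (simp add: scaleR_diff_left sum_subtractf)
  then have "\<forall>b\<in>B. g x b - f b = 0"
    using real_vector.independentD[OF B(1) fin subset_refl, of "\<lambda>b. g x b - f b"] by blast
  then have gx: "g x y = f y" for y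
    using linear_eq_on_span[OF gr[of x] assms(3), of B y] B by auto
  have "x' = x" if "\<forall>y. g x' y = f y" for x'
  proof -
    have "\<forall>b\<in>B. g (x' - x) b = 0"
      using that gx by (simp add: linear_diff[OF gl])
    then show ?thesis using zero[of "x' - x"] by simp
  qed
  then show ?thesis using gx by blast
qed

text \<open>Existence and uniqueness of the Levi-Civita connection, through the Koszul formula.\<close>

lemma ex1_levi_civita:
  fixes br :: "'a::real_vector \<Rightarrow> 'a \<Rightarrow> 'a"
  assumes dim: "dim (UNIV :: 'a set) > 0" and L: "lie_algebra br" and g: "inner_product_form g"
  shows "\<exists>!nab. is_levi_civita br g nab"
proof -
  define K where "K x y z = (g (br x y) z - g (br y z) x + g (br z x) y) / 2" for x y z
  have gl: "linear (\<lambda>x. g x y)" and gr: "linear (g x)" and gs: "g x y = g y x" for x y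
    using g by (auto simp: inner_product_form_def bilinear_def)
  have bl: "linear (\<lambda>x. br x y)" and b_r: "linear (br x)" and ba: "br x x = 0" for x y
    using L by (auto simp: lie_algebra_def bilinear_def)
  have bs: "br y x = - br x y" for x y
    using ba[of "x + y"] ba[of x] ba[of y]
    by (simp add: linear_add[OF bl] linear_add[OF b_r] add_eq_0_iff)
  note lins = linear_add[OF bl] linear_add[OF b_r] linear_cmul[OF bl] linear_cmul[OF b_r]
    linear_add[OF gl] linear_add[OF gr] linear_cmul[OF gl] linear_cmul[OF gr]
    linear_diff[OF gl] linear_diff[OF gr] linear_neg[OF gl] linear_neg[OF gr]
  have Kl: "linear (K x y)" for x y
    unfolding K_def by (intro linearI) (simp_all add: lins field_simps)
  define nab where "nab x y = (THE w. \<forall>z. g w z = K x y z)" for x y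
  have nab: "g (nab x y) z = K x y z" for x y z
    using theI'[OF inner_product_form_riesz[OF dim g Kl[of x y]]] unfolding nab_def by blast
  have eqI: "u = v" if "\<And>z. g u z = g v z" for u v
  proof -
    have "g (u - v) (u - v) = 0" using that by (simp add: lins)
    then show ?thesis using g unfolding inner_product_form_def by (metis less_irrefl right_minus_eq)
  qed
  have 1: "bilinear nab"
    unfolding bilinear_def
    by (intro conjI allI linearI; rule eqI) (simp_all add: nab lins K_def field_simps)
  have 2: "nab x y - nab y x = br x y" for x y
  proof (rule eqI)
    fix z
    show "g (nab x y - nab y x) z = g (br x y) z"
      by (simp add: nab lins K_def bs[of x y] bs[of y z] bs[of z x] field_simps)
  qed
  have 3: "g (nab x y) z + g y (nab x z) = 0" for x y z
    unfolding gs[of y "nab x z"] nab K_def bs[of x y] bs[of y z] bs[of z x] by (simp add: lins field_simps)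
  have ex: "is_levi_civita br g nab"
    unfolding is_levi_civita_def using 1 2 3 by blast
  have "n = nab" if n: "is_levi_civita br g n" for n
  proof (intro ext eqI)
    fix x y z
    have t: "g (br x y) z = g (n x y) z - g (n y x) z" for x y z
      using n unfolding is_levi_civita_def by (metis linear_diff[OF gl])
    have m: "g (n x y) z = - g (n x z) y" for x y z
      using n gs[of y "n x z"] unfolding is_levi_civita_def by (metis add_eq_0_iff2)
    show "g (n x y) z = g (nab x y) z"
      unfolding nab K_def t using m[of x y z] m[of y z x] m[of z x y] by simp
  qed
  with ex show ?thesis by blast
qed

end

theory Submission
  imports Defs
begin

text \<open>A nonzero central element of a Sasakian Lie algebra is a multiple of \<open>\<xi>\<close>, so the algebra is the
  central extension, by its Kaehler form, of a \<open>4\<close>-dimensional Kaehler Lie algebra \<open>\<hh> = \<gg>/\<real>\<xi>\<close>, and being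
  \<open>\<eta>\<close>-Einstein means that \<open>\<hh>\<close> is Einstein. There is a unit vector \<open>A\<close> in \<open>\<hh>\<close> whose dual form is closed
  and such that \<open>tr ad\<close> vanishes on its orthogonal complement: if \<open>\<hh>\<close> is not unimodular, take the gradient
  of \<open>x \<mapsto> tr ad x\<close>; if it is, the map \<open>\<beta> \<mapsto> (d\<beta>)\<^sup>+\<close> from \<open>\<real>\<^sup>4\<close> to the \<open>3\<close>-dimensional space of
  self-dual forms has a kernel, on which \<open>0 = d(\<beta> \<and> d\<beta>) = -|d\<beta>|\<^sup>2\<close>. In a frame \<open>A, \<phi>A, e, \<phi>e\<close> with \<open>e\<close> chosen
  so that the shape operator \<open>S = \<nabla>A\<close> has no \<open>(e, \<phi>e)\<close> entry, the bracket depends on seven parameters.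
  Since \<open>Ric(A, A) = -|S|\<^sup>2\<close>, either \<open>S = 0\<close>, which leads to \<open>\<gg>\<^sub>1\<close> and \<open>\<gg>\<^sub>3\<close>, or the Einstein constant is
  negative, in which case the equations leave only \<open>\<gg>\<^sub>4\<close>, \<open>\<gg>\<^sub>5\<close> and \<open>\<gg>\<^sub>7\<close>. The algebras are told apart by
  the functions \<open>x \<mapsto> tr ad x\<close> and \<open>x \<mapsto> tr (ad x)\<^sup>2\<close>.\<close>

section \<open>Traces and transport of structure\<close>

text \<open>A basis and its image under \<open>F\<close> give \<open>f'\<close> and \<open>f\<close>
  the same matrix, and \<open>lin_trace\<close> may be computed in any basis.\<close>

lemma lin_trace_conj:
  fixes F :: "'b::real_vector \<Rightarrow> 'a::real_vector"
  assumes "dim (UNIV :: 'b set) > 0" "dim (UNIV :: 'a set) > 0"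
    and F: "linear F" "bij F" and "linear f" "linear f'" and eq: "\<And>x. F (f' x) = f (F x)"
  shows "lin_trace f' = lin_trace f"
proof -
  obtain B :: "'b set" where B: "independent B" "span B = UNIV"
    using real_vector.basis_exists[of UNIV] by (metis real_vector.span_UNIV real_vector.span_subspace top_greatest
      UNIV_I subsetI subset_antisym)
  have inj: "inj F" using F by (simp add: bij_def)
  have C: "independent (F ` B)" "span (F ` B) = UNIV"
    using B F inj by (auto simp: linear_independent_injective_image linear_span_image bij_def)
  have fin: "finite B" using finite_basis_if_dim assms(1) B by blast
  have rep: "representation (F ` B) (F v) (F b) = representation B v b" if "b \<in> B" for v b
  proof -
    have 1: "F v = (\<Sum>b\<in>B. representation B v b *\<^sub>R F b)"
    proof -
      have "F v = F (\<Sum>b\<in>B. representation B v b *\<^sub>R b)"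
        using real_vector.sum_representation_eq[OF B(1), of v B] B fin by simp
      also have "\<dots> = (\<Sum>b\<in>B. representation B v b *\<^sub>R F b)"
        by (simp add: linear_sum[OF F(1)] linear_cmul[OF F(1)])
      finally show ?thesis .
    qed
    have r: "representation (F ` B) (F c) (F b) = (if c = b then 1 else 0)" if "c \<in> B" for c
      using real_vector.representation_basis[OF C(1), of "F c"] that inj by (auto simp: inj_eq)
    have "representation (F ` B) (F v) (F b) = (\<Sum>c\<in>B. representation B v c * (if c = b then 1 else 0))"
      unfolding 1 using C r
      by (simp add: real_vector.representation_sum real_vector.representation_scale)
    also have "\<dots> = representation B v b"
      using fin that by (simp add: if_distrib cong: if_cong)
    finally show ?thesis .
  qed
  have "lin_trace f = (\<Sum>c\<in>F ` B. representation (F ` B) (f c) c)"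
    by (rule lin_trace_eq) (use assms C in auto)
  also have "\<dots> = (\<Sum>b\<in>B. representation (F ` B) (f (F b)) (F b))"
    using sum.reindex[OF inj_on_subset[OF inj subset_UNIV]] by (simp add: o_def)
  also have "\<dots> = (\<Sum>b\<in>B. representation B (f' b) b)"
  proof (rule sum.cong[OF refl])
    fix b assume "b \<in> B"
    then show "representation (F ` B) (f (F b)) (F b) = representation B (f' b) b"
      using rep[of b "f' b"] eq[of b] by metis
  qed
  also have "\<dots> = lin_trace f'"
    using lin_trace_eq[OF assms(1) \<open>linear f'\<close> B] by simp
  finally show ?thesis by simp
qed

lemma sum_5: "sum f (UNIV :: 5 set) = f 1 + f 2 + f 3 + f 4 + f 5"
proof -
  have U: "(UNIV :: 5 set) = {1, 2, 3, 4, 5}" using exhaust_5 by auto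
  show ?thesis unfolding U by (simp add: ac_simps)
qed

lemma lin_trace_cart:
  assumes "linear f"
  shows "lin_trace (f :: real^'n \<Rightarrow> real^'n) = (\<Sum>i\<in>UNIV. f (axis i 1) $ i)"
proof -
  have B: "independent (Basis :: (real^'n) set)" "span (Basis :: (real^'n) set) = UNIV"
    by (auto simp: independent_Basis)
  have rep: "representation Basis v b = v \<bullet> b" if "b \<in> Basis" for v b :: "real^'n"
  proof -
    have "v \<bullet> b = (\<Sum>c\<in>Basis. representation Basis v c *\<^sub>R c) \<bullet> b"
      using real_vector.sum_representation_eq[OF B(1), of v Basis] by simp
    also have "\<dots> = (\<Sum>c\<in>Basis. representation Basis v c * (c \<bullet> b))"
      by (simp add: inner_sum_left)
    also have "\<dots> = representation Basis v b"
      using that by (simp add: inner_Basis if_distrib cong: if_cong)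
    finally show ?thesis by simp
  qed
  have "lin_trace f = (\<Sum>b\<in>Basis. representation Basis (f b) b)"
    by (rule lin_trace_eq) (use assms B in auto)
  also have "\<dots> = (\<Sum>b\<in>Basis. f b \<bullet> b)"
    by (intro sum.cong) (simp_all add: rep)
  also have "\<dots> = (\<Sum>b\<in>(\<lambda>i. axis i 1) ` UNIV. f b \<bullet> b)"
    by (rule sum.cong) (auto simp: Basis_vec_def)
  also have "\<dots> = (\<Sum>i\<in>UNIV. f (axis i 1) $ i)"
    by (subst sum.reindex) (auto simp: inj_on_def axis_eq_axis inner_axis)
  finally show ?thesis .
qed

section \<open>Naturality of the connection, the Ricci tensor and the Sasakian structure\<close>

lemma levi_civita_eqI:
  fixes br :: "'a::real_vector \<Rightarrow> 'a \<Rightarrow> 'a"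
  assumes "dim (UNIV :: 'a set) > 0" "lie_algebra br" "inner_product_form g"
    and "is_levi_civita br g nab"
  shows "levi_civita br g = nab"
  unfolding levi_civita_def by (rule the1_equality[OF ex1_levi_civita]) (use assms in auto)

lemma is_levi_civita_levi_civita:
  fixes br :: "'a::real_vector \<Rightarrow> 'a \<Rightarrow> 'a"
  assumes "dim (UNIV :: 'a set) > 0" "lie_algebra br" "inner_product_form g"
  shows "is_levi_civita br g (levi_civita br g)"
  unfolding levi_civita_def by (rule theI'[OF ex1_levi_civita]) (use assms in auto)

text \<open>Each axiom can be tested after applying the injective map \<open>F\<close>, where it
  becomes an axiom of \<open>br\<close>; even bilinearity of \<open>br'\<close> comes out this
  way.\<close>

lemma lie_algebra_pullback:
  assumes F: "linear F" "inj F" and hom: "\<And>x y. F (br' x y) = br (F x) (F y)"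
    and L: "lie_algebra br"
  shows "lie_algebra br'"
proof -
  have bl: "linear (\<lambda>x. br x y)" and b_r: "linear (br x)" for x y
    using L by (auto simp: lie_algebra_def bilinear_def)
  note s = linear_add[OF F(1)] linear_cmul[OF F(1)] hom linear_add[OF bl] linear_cmul[OF bl]
    linear_add[OF b_r] linear_cmul[OF b_r] linear_0[OF F(1)]
  have "bilinear br'"
    unfolding bilinear_def by (intro conjI allI linearI; rule injD[OF F(2)]) (simp_all add: s)
  moreover have "br' x x = 0" for x
    by (rule injD[OF F(2)]) (use L in \<open>simp add: s lie_algebra_def\<close>)
  moreover have "br' x (br' y z) + br' y (br' z x) + br' z (br' x y) = 0" for x y z
    by (rule injD[OF F(2)]) (use L in \<open>simp add: s lie_algebra_def\<close>)
  ultimately show ?thesis by (simp add: lie_algebra_def)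
qed

lemma inner_product_form_pullback:
  assumes F: "linear F" "inj F" and g': "\<And>x y. g' x y = g (F x) (F y)"
    and g: "inner_product_form g"
  shows "inner_product_form g'"
proof -
  have gl: "linear (\<lambda>x. g x y)" and gr: "linear (g x)" for x y
    using g by (auto simp: inner_product_form_def bilinear_def)
  have "F x \<noteq> 0" if "x \<noteq> 0" for x
    using that F by (metis injD linear_0)
  moreover have "bilinear g'"
    unfolding bilinear_def
    by (intro conjI allI linearI) (simp_all add: g' linear_add[OF F(1)] linear_cmul[OF F(1)]
      linear_add[OF gl] linear_cmul[OF gl] linear_add[OF gr] linear_cmul[OF gr])
  ultimately show ?thesis
    using g by (simp add: inner_product_form_def g')
qed

lemma linear_curvature:
  fixes br :: "'a::real_vector \<Rightarrow> 'a \<Rightarrow> 'a"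
  assumes "dim (UNIV :: 'a set) > 0" "lie_algebra br" "inner_product_form g"
  shows "linear (\<lambda>x. curvature br g x y z)"
proof -
  have n: "bilinear (levi_civita br g)"
    using is_levi_civita_levi_civita[OF assms] by (simp add: is_levi_civita_def)
  have b: "bilinear br" using assms by (simp add: lie_algebra_def)
  show ?thesis
    unfolding curvature_def
    by (rule linearI) (simp_all add: bilinear_ladd[OF n] bilinear_radd[OF n] bilinear_lmul[OF n]
      bilinear_rmul[OF n] bilinear_ladd[OF b] bilinear_lmul[OF b] scaleR_diff_right)
qed

text \<open>The connection of \<open>br\<close> pulled back through \<open>F\<close> is torsion-free
  and metric for \<open>br'\<close> and \<open>g'\<close>, so by uniqueness it is their Levi-Civita
  connection. Hence \<open>F\<close> intertwines the curvature endomorphisms and their traces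
  agree.\<close>

lemma ricci_pullback:
  fixes F :: "'b::real_vector \<Rightarrow> 'a::real_vector"
  assumes dim: "dim (UNIV :: 'b set) > 0" "dim (UNIV :: 'a set) > 0"
    and F: "linear F" "bij F" and hom: "\<And>x y. F (br' x y) = br (F x) (F y)"
    and g': "\<And>x y. g' x y = g (F x) (F y)"
    and L: "lie_algebra br" and g: "inner_product_form g"
  shows "ricci br' g' x y = ricci br g (F x) (F y)"
proof -
  have inj: "inj F" using F by (simp add: bij_def)
  note L' = lie_algebra_pullback[OF F(1) inj hom L]
  note ip' = inner_product_form_pullback[OF F(1) inj g' g]
  define n where "n = levi_civita br g"
  define n' where "n' x y = inv F (n (F x) (F y))" for x y
  have n: "is_levi_civita br g n"
    unfolding n_def by (rule is_levi_civita_levi_civita[OF dim(2) L g])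
  have nl: "linear (\<lambda>x. n x y)" and nr: "linear (n x)" for x y
    using n by (auto simp: is_levi_civita_def bilinear_def)
  have n': "F (n' x y) = n (F x) (F y)" for x y
    unfolding n'_def using F by (simp add: bij_def surj_f_inv_f)
  have "is_levi_civita br' g' n'"
    unfolding is_levi_civita_def
  proof (intro conjI allI)
    show "bilinear n'"
      unfolding bilinear_def
      by (intro conjI allI linearI; rule injD[OF inj])
        (simp_all add: n' linear_add[OF F(1)] linear_cmul[OF F(1)]
          linear_add[OF nl] linear_cmul[OF nl] linear_add[OF nr] linear_cmul[OF nr])
    show "n' x y - n' y x = br' x y" for x y
      by (rule injD[OF inj]) (use n in \<open>simp add: is_levi_civita_def linear_diff[OF F(1)] n' hom\<close>)
    show "g' (n' x y) z + g' y (n' x z) = 0" for x y z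
      using n by (simp add: is_levi_civita_def g' n')
  qed
  then have n'_eq: "levi_civita br' g' = n'"
    by (rule levi_civita_eqI[OF dim(1) L' ip'])
  have "F (curvature br' g' x y z) = curvature br g (F x) (F y) (F z)" for x y z
    unfolding curvature_def n'_eq n_def[symmetric] by (simp add: linear_diff[OF F(1)] n' hom)
  then show ?thesis
    unfolding ricci_def
    using lin_trace_conj[OF dim F] linear_curvature[OF dim(2) L g] linear_curvature[OF dim(1) L' ip']
    by blast
qed

definition sasakian_eta_einstein where
  "sasakian_eta_einstein br \<phi> \<xi> \<eta> g \<longleftrightarrow> sasakian br \<phi> \<xi> \<eta> g \<and> eta_einstein br \<eta> g"

lemma sasakian_eta_einstein_pullback:
  fixes F :: "'b::real_vector \<Rightarrow> 'a::real_vector"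
  assumes dim: "dim (UNIV :: 'b set) = dim (UNIV :: 'a set)"
    and F: "linear F" "bij F" and hom: "\<And>x y. F (br' x y) = br (F x) (F y)"
    and \<phi>': "\<And>x. F (\<phi>' x) = \<phi> (F x)" and \<xi>': "F \<xi>' = \<xi>" and \<eta>': "\<And>x. \<eta>' x = \<eta> (F x)"
    and g': "\<And>x y. g' x y = g (F x) (F y)"
    and S: "sasakian_eta_einstein br \<phi> \<xi> \<eta> g"
  shows "sasakian_eta_einstein br' \<phi>' \<xi>' \<eta>' g'"
proof -
  have inj: "inj F" using F by (simp add: bij_def)
  have L: "lie_algebra br" and g: "inner_product_form g" and lin: "linear \<phi>" "linear \<eta>"
    and odd: "odd (dim (UNIV :: 'a set))"
    and \<phi>2: "\<phi> (\<phi> x) = - x + \<eta> x *\<^sub>R \<xi>" and "\<eta> \<xi> = 1"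
    and gg: "g (\<phi> x) (\<phi> y) = g x y - \<eta> x * \<eta> y"
    and N: "normality_tensor br \<phi> \<xi> \<eta> x y = 0"
    and d: "ce_d br \<eta> x y = 2 * fundamental_form \<phi> g x y" for x y
    using S by (auto simp: sasakian_eta_einstein_def sasakian_def almost_contact_metric_def)
  note s = linear_add[OF F(1)] linear_cmul[OF F(1)] linear_neg[OF F(1)] linear_diff[OF F(1)]
    linear_0[OF F(1)] hom \<phi>' \<xi>' \<eta>' g'
    linear_add[OF lin(1)] linear_cmul[OF lin(1)] linear_add[OF lin(2)] linear_cmul[OF lin(2)]
  note L' = lie_algebra_pullback[OF F(1) inj hom L]
  note ip' = inner_product_form_pullback[OF F(1) inj g' g]
  have "linear \<phi>'"
    by (intro linearI; rule injD[OF inj]) (simp_all add: s)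
  moreover have "linear \<eta>'"
    by (intro linearI) (simp_all add: s)
  moreover have "\<phi>' (\<phi>' x) = - x + \<eta>' x *\<^sub>R \<xi>'" for x
    by (rule injD[OF inj]) (simp add: s \<phi>2)
  moreover have "normality_tensor br' \<phi>' \<xi>' \<eta>' x y = 0" for x y
  proof (rule injD[OF inj])
    have "F (normality_tensor br' \<phi>' \<xi>' \<eta>' x y) = normality_tensor br \<phi> \<xi> \<eta> (F x) (F y)"
      unfolding normality_tensor_def ce_d_def by (simp only: s)
    then show "F (normality_tensor br' \<phi>' \<xi>' \<eta>' x y) = F 0" by (simp add: N linear_0[OF F(1)])
  qed
  moreover have "ce_d br' \<eta>' x y = 2 * fundamental_form \<phi>' g' x y" for x y
    using d[of "F x" "F y"] by (simp add: hom \<phi>' \<eta>' g' ce_d_def fundamental_form_def)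
  moreover have gg': "g' (\<phi>' x) (\<phi>' y) = g' x y - \<eta>' x * \<eta>' y" for x y
    by (simp add: \<phi>' \<eta>' g' gg)
  ultimately have 1: "sasakian br' \<phi>' \<xi>' \<eta>' g'"
    unfolding sasakian_def almost_contact_metric_def
    using L' ip' odd \<open>\<eta> \<xi> = 1\<close> dim gg' by (simp add: \<xi>' \<eta>')
  have "0 < dim (UNIV :: 'a set)" using odd by (rule odd_pos)
  then have "ricci br' g' x y = ricci br g (F x) (F y)" for x y
    using dim by (intro ricci_pullback) (use F hom g' L g in auto)
  then have "eta_einstein br' \<eta>' g'"
    using S unfolding sasakian_eta_einstein_def eta_einstein_def \<eta>' g' by metis
  with 1 show ?thesis by (simp add: sasakian_eta_einstein_def)
qed

section \<open>A seven-parameter family of Sasakian Lie algebras\<close>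

text \<open>In the frame \<open>A, B = \<phi>A, e, f = \<phi>e, \<xi>\<close>: the matrix of \<open>\<nabla>A\<close> on \<open>B, e, f\<close> is symmetric with diagonal
  \<open>(a, c1, c2)\<close> and off-diagonal entries \<open>b1\<close>, \<open>b2\<close>, \<open>0\<close>, and \<open>p\<close>, \<open>q\<close> are the horizontal components
  \<open>g (\<nabla>\<^sub>A e) f\<close>, \<open>g (\<nabla>\<^sub>B e) f\<close>. The Jacobi identity is not implied.\<close>

definition normal_bracket ::
    "real \<Rightarrow> real \<Rightarrow> real \<Rightarrow> real \<Rightarrow> real \<Rightarrow> real \<Rightarrow> real \<Rightarrow> real^5 \<Rightarrow> real^5 \<Rightarrow> real^5" where
  "normal_bracket a b1 b2 c1 c2 p q x y = vector
    [0,
     - a * e2 1 2 x y - b1 * e2 1 3 x y - b2 * e2 1 4 x y + b2 * e2 2 3 x y - b1 * e2 2 4 x y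
       - (c1 + c2) * e2 3 4 x y,
     - b1 * e2 1 2 x y - c1 * e2 1 3 x y - p * e2 1 4 x y + (c2 - q) * e2 2 4 x y + b1 * e2 3 4 x y,
     - b2 * e2 1 2 x y + p * e2 1 3 x y - c2 * e2 1 4 x y + (q - c1) * e2 2 3 x y + b2 * e2 3 4 x y,
     2 * e2 1 2 x y + 2 * e2 3 4 x y]"

text \<open>The tensor \<phi> in the frame \<open>A, B, e, f, \<xi>\<close> of the family.\<close>

definition std_phi :: "real^5 \<Rightarrow> real^5" where
  "std_phi x = vector [- x $ 2, x $ 1, - x $ 4, x $ 3, 0]"

text \<open>The solution of the Koszul formula for \<open>normal_bracket\<close> and
  \<open>inner\<close>. The terms free of parameters come from the \<xi>-component of the
  bracket.\<close>

definition normal_connection ::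
    "real \<Rightarrow> real \<Rightarrow> real \<Rightarrow> real \<Rightarrow> real \<Rightarrow> real \<Rightarrow> real \<Rightarrow> real^5 \<Rightarrow> real^5 \<Rightarrow> real^5" where
  "normal_connection a b1 b2 c1 c2 p q x y = vector
    [- a * x $ 2 * y $ 2 - b1 * x $ 2 * y $ 3 - b2 * x $ 2 * y $ 4 + x $ 2 * y $ 5 - b1 * x $ 3 * y $ 2
       - c1 * x $ 3 * y $ 3 - b2 * x $ 4 * y $ 2 - c2 * x $ 4 * y $ 4 + x $ 5 * y $ 2,
     - x $ 1 * y $ 5 + a * x $ 2 * y $ 1 + b2 * x $ 2 * y $ 3 - b1 * x $ 2 * y $ 4 + b1 * x $ 3 * y $ 1
       - c1 * x $ 3 * y $ 4 + b2 * x $ 4 * y $ 1 + c2 * x $ 4 * y $ 3 - x $ 5 * y $ 1,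
     - p * x $ 1 * y $ 4 + b1 * x $ 2 * y $ 1 - b2 * x $ 2 * y $ 2 - q * x $ 2 * y $ 4 + c1 * x $ 3 * y $ 1
       + b1 * x $ 3 * y $ 4 - c2 * x $ 4 * y $ 2 + b2 * x $ 4 * y $ 4 + x $ 4 * y $ 5 + x $ 5 * y $ 4,
     p * x $ 1 * y $ 3 + b2 * x $ 2 * y $ 1 + b1 * x $ 2 * y $ 2 + q * x $ 2 * y $ 3 + c1 * x $ 3 * y $ 2
       - b1 * x $ 3 * y $ 3 - x $ 3 * y $ 5 + c2 * x $ 4 * y $ 1 - b2 * x $ 4 * y $ 3 - x $ 5 * y $ 3,
     x $ 1 * y $ 2 - x $ 2 * y $ 1 + x $ 3 * y $ 4 - x $ 4 * y $ 3]"

lemma inner_5: "(x :: real^5) \<bullet> y = x$1 * y$1 + x$2 * y$2 + x$3 * y$3 + x$4 * y$4 + x$5 * y$5"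
  by (simp add: inner_vec_def sum_5)

lemma dim_real5: "dim (UNIV :: (real^5) set) = 5"
  by simp

lemma inner_product_form_inner: "inner_product_form (inner :: 'a::real_inner \<Rightarrow> 'a \<Rightarrow> real)"
  by (simp add: inner_product_form_def bilinear_def linear_iff inner_add_left inner_add_right inner_commute)

lemma bilinear_normal_connection: "bilinear (normal_connection a b1 b2 c1 c2 p q)"
  unfolding bilinear_def linear_iff vec_eq_iff forall_5 normal_connection_def vector_5
    vector_add_component vector_scaleR_component real_scaleR_def
  by (intro conjI allI; algebra)

lemma is_levi_civita_normal:
  "is_levi_civita (normal_bracket a b1 b2 c1 c2 p q) inner (normal_connection a b1 b2 c1 c2 p q)"
  unfolding is_levi_civita_def
proof (intro conjI allI bilinear_normal_connection)
  fix x y z :: "real^5"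
  show "normal_connection a b1 b2 c1 c2 p q x y - normal_connection a b1 b2 c1 c2 p q y x
      = normal_bracket a b1 b2 c1 c2 p q x y"
    unfolding vec_eq_iff forall_5 normal_connection_def normal_bracket_def vector_5 e2_def
      vector_minus_component
    by (intro conjI; algebra)
  show "normal_connection a b1 b2 c1 c2 p q x y \<bullet> z + y \<bullet> normal_connection a b1 b2 c1 c2 p q x z = 0"
    unfolding inner_5 normal_connection_def vector_5 by algebra
qed

lemma axis_5:
  "(axis 1 1 :: real^5) = vector [1, 0, 0, 0, 0]" "(axis 2 1 :: real^5) = vector [0, 1, 0, 0, 0]"
  "(axis 3 1 :: real^5) = vector [0, 0, 1, 0, 0]" "(axis 4 1 :: real^5) = vector [0, 0, 0, 1, 0]"
  "(axis 5 1 :: real^5) = vector [0, 0, 0, 0, 1]"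
  by (simp_all add: vec_eq_iff forall_5 vector_5 axis_def)

text \<open>By uniqueness \<open>normal_connection\<close> is the Levi-Civita connection, so the
  trace of the curvature is a polynomial. The four entries \<open>- 2\<close> and the entry
  \<open>4\<close> come from the extension by \<xi>; the other terms are the Ricci tensor of the
  Kaehler quotient.\<close>

lemma ricci_normal:
  assumes "lie_algebra (normal_bracket a b1 b2 c1 c2 p q)"
  shows "ricci (normal_bracket a b1 b2 c1 c2 p q) inner y z =
    (- 2 - a^2 - 2 * b1^2 - 2 * b2^2 - c1^2 - c2^2) * (y$1 * z$1)
    + (- 2 - a^2 - a * (c1 + c2) + 2 * c1 * c2) * (y$2 * z$2)
    + (- 2 - a * c1 - 2 * b2^2 - c1^2 - c1 * c2 - 2 * c2 * q) * (y$3 * z$3)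
    + (- 2 - a * c2 - 2 * b1^2 - c2^2 - c1 * c2 - 2 * c1 * q) * (y$4 * z$4)
    + 4 * (y$5 * z$5)
    - b2 * (a + q) * (y$1 * z$3 + y$3 * z$1) + b1 * (a + q) * (y$1 * z$4 + y$4 * z$1)
    + (b2 * p - b1 * (a + c1 + 3 * c2)) * (y$2 * z$3 + y$3 * z$2)
    - (b1 * p + b2 * (a + 3 * c1 + c2)) * (y$2 * z$4 + y$4 * z$2)
    + (2 * b1 * b2 - p * (c1 - c2)) * (y$3 * z$4 + y$4 * z$3)"
proof -
  let ?b = "normal_bracket a b1 b2 c1 c2 p q" and ?n = "normal_connection a b1 b2 c1 c2 p q"
  have n: "levi_civita ?b inner = ?n"
    by (rule levi_civita_eqI) (use assms is_levi_civita_normal in \<open>auto simp: inner_product_form_inner\<close>)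
  have lin: "linear (\<lambda>x. curvature ?b inner x y z)"
    by (rule linear_curvature) (use assms in \<open>auto simp: inner_product_form_inner\<close>)
  show ?thesis
    unfolding ricci_def lin_trace_cart[OF lin]
    unfolding sum_5 axis_5 curvature_def n
    unfolding vector_minus_component normal_connection_def normal_bracket_def vector_5 e2_def
      mult_zero_left mult_zero_right mult_1_left mult_1_right add_0 add_0_right diff_0 diff_0_right
      minus_zero
    by algebra
qed

text \<open>The hypotheses say that Ric takes the same value on \<open>B\<close>, \<open>e\<close>,
  \<open>f\<close> as on \<open>A\<close> and that its \<open>(e, f)\<close> entry vanishes. The
  coefficient of \<eta> \<otimes> \<eta> is the excess of the value \<open>4\<close> on \<xi> over
  that common value.\<close>

lemma eta_einstein_normal:
  assumes "lie_algebra (normal_bracket a 0 0 c1 c2 p q)"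
    and "a^2 + c1^2 + c2^2 = a^2 + a * (c1 + c2) - 2 * c1 * c2"
    and "a^2 + c1^2 + c2^2 = a * c1 + c1^2 + c1 * c2 + 2 * c2 * q"
    and "a^2 + c1^2 + c2^2 = a * c2 + c2^2 + c1 * c2 + 2 * c1 * q"
    and "p * (c1 - c2) = 0"
  shows "eta_einstein (normal_bracket a 0 0 c1 c2 p q) (\<lambda>x. x $ 5) inner"
proof -
  have "ricci (normal_bracket a 0 0 c1 c2 p q) inner x y
      = (- 2 - (a^2 + c1^2 + c2^2)) * (x \<bullet> y) + (6 + (a^2 + c1^2 + c2^2)) * (x $ 5 * y $ 5)" for x y
  proof -
    have "- 2 - a\<^sup>2 - a * (c1 + c2) + 2 * c1 * c2 = - 2 - (a^2 + c1^2 + c2^2)"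
      "- 2 - a * c1 - 2 * 0\<^sup>2 - c1\<^sup>2 - c1 * c2 - 2 * c2 * q = - 2 - (a^2 + c1^2 + c2^2)"
      "- 2 - a * c2 - 2 * 0\<^sup>2 - c2\<^sup>2 - c1 * c2 - 2 * c1 * q = - 2 - (a^2 + c1^2 + c2^2)"
      using assms(2-4) by simp_all
    note coeffs = this assms(5)
    show ?thesis
      unfolding ricci_normal[OF assms(1)] inner_5 coeffs by (simp add: algebra_simps)
  qed
  then show ?thesis unfolding eta_einstein_def by blast
qed

lemma sasakian_normal:
  assumes "lie_algebra (normal_bracket a b1 b2 c1 c2 p q)"
  shows "sasakian (normal_bracket a b1 b2 c1 c2 p q) std_phi (axis 5 1) (\<lambda>x. x $ 5) inner"
  unfolding sasakian_def almost_contact_metric_def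
proof (intro conjI allI assms inner_product_form_inner)
  fix x y :: "real^5"
  show "odd (dim (UNIV :: (real^5) set))" by simp
  show "linear std_phi" "linear (\<lambda>x::real^5. x $ 5)"
    by (simp_all add: linear_iff std_phi_def vec_eq_iff forall_5 vector_5)
  show "std_phi (std_phi x) = - x + x $ 5 *\<^sub>R axis 5 1"
    by (simp add: std_phi_def vec_eq_iff forall_5 vector_5 axis_5)
  show "(axis 5 1 :: real^5) $ 5 = 1" by simp
  show "std_phi x \<bullet> std_phi y = x \<bullet> y - x $ 5 * y $ 5"
    by (simp add: std_phi_def inner_5 vector_5)
  show "normality_tensor (normal_bracket a b1 b2 c1 c2 p q) std_phi (axis 5 1) (\<lambda>x. x $ 5) x y = 0"
    unfolding normality_tensor_def ce_d_def vec_eq_iff forall_5 vector_add_component vector_minus_component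
      vector_scaleR_component std_phi_def normal_bracket_def vector_5 e2_def axis_5 real_scaleR_def zero_index
    by (intro conjI; algebra)
  show "ce_d (normal_bracket a b1 b2 c1 c2 p q) (\<lambda>x. x $ 5) x y = 2 * fundamental_form std_phi inner x y"
    unfolding ce_d_def fundamental_form_def inner_5 std_phi_def normal_bracket_def vector_5 e2_def
    by algebra
qed

section \<open>Isomorphisms\<close>

lemma lie_isomorphic_sym: "br \<simeq>\<^sub>L br' \<Longrightarrow> br' \<simeq>\<^sub>L br"
proof -
  assume "br \<simeq>\<^sub>L br'"
  then obtain f where f: "linear f" "bij f" "\<And>x y. f (br x y) = br' (f x) (f y)"
    unfolding lie_isomorphic_def by blast
  note inj = bij_is_inj[OF f(2)] and surj = surj_f_inv_f[OF bij_is_surj[OF f(2)]]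
  have "linear (inv f)"
    by (intro linearI; rule injD[OF inj]) (simp_all add: surj linear_add[OF f(1)] linear_cmul[OF f(1)])
  moreover have "inv f (br' x y) = br (inv f x) (inv f y)" for x y
    by (rule injD[OF inj]) (simp add: surj f(3))
  ultimately show "br' \<simeq>\<^sub>L br"
    unfolding lie_isomorphic_def using bij_imp_bij_inv[OF f(2)] by blast
qed

lemma lie_isomorphic_trans: "br \<simeq>\<^sub>L br' \<Longrightarrow> br' \<simeq>\<^sub>L br'' \<Longrightarrow> br \<simeq>\<^sub>L br''"
  unfolding lie_isomorphic_def by (metis (no_types, lifting) bij_comp comp_apply linear_compose)

lemma lie_isomorphicI:
  assumes "linear f" "\<And>x. f' (f x) = x" "\<And>y. f (f' y) = y" "\<And>x y. f (br x y) = br' (f x) (f y)"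
  shows "br \<simeq>\<^sub>L br'"
proof -
  have "bij f" by (rule bijI') (use assms(2,3) in metis)+
  then show ?thesis unfolding lie_isomorphic_def using assms(1,4) by blast
qed

lemmas iso_simps = linear_iff vec_eq_iff forall_5 vector_5 e2_def normal_bracket_def

text \<open>The vector \<open>2\<xi> = [A, B] = [e, f]\<close> has to become
  \<open>- e\<^sub>5\<close>, whence the rescaling.\<close>

lemma normal_iso_g1: "normal_bracket 0 0 0 0 0 0 0 \<simeq>\<^sub>L \<gg>\<^sub>1"
  by (rule lie_isomorphicI[where f = "\<lambda>x. vector [x$1, x$2, x$3, x$4, - x$5 / 2]"
        and f' = "\<lambda>x. vector [x$1, x$2, x$3, x$4, - 2 * x$5]"])
    (simp_all add: iso_simps \<gg>\<^sub>1_def field_simps)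

lemma normal_iso_g3:
  assumes "p \<noteq> 0 \<or> q \<noteq> 0"
  shows "normal_bracket 0 0 0 0 0 p q \<simeq>\<^sub>L \<gg>\<^sub>3"
proof -
  define r where "r = p^2 + q^2"
  have "r \<noteq> 0" using assms by (auto simp: r_def sum_power2_eq_zero_iff)
  \<comment> \<open>\<open>e\<^sub>1 = (pA + qB)/r\<close>, \<open>e\<^sub>2 = e\<close>, \<open>e\<^sub>3 = -f\<close>, \<open>e\<^sub>4 = qA - pB\<close>, \<open>e\<^sub>5 = 2\<xi>\<close>\<close>
  define f :: "real^5 \<Rightarrow> real^5" where
    "f x = vector [p * x$1 / r + q * x$4, q * x$1 / r - p * x$4, x$2, - x$3, 2 * x$5]" for x
  define f' :: "real^5 \<Rightarrow> real^5" where
    "f' x = vector [p * x$1 + q * x$2, x$3, - x$4, (q * x$1 - p * x$2) / r, x$5 / 2]" for x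
  \<comment> \<open>\<open>r\<close> stays opaque so that one can divide by it; these equations
    eliminate the square of \<open>p\<close> instead.\<close>
  have rr: "p * (p * t) = r * t - q * (q * t)" "p * p = r - q * q" for t
    by (simp_all add: r_def power2_eq_square algebra_simps)
  have "\<gg>\<^sub>3 \<simeq>\<^sub>L normal_bracket 0 0 0 0 0 p q"
    by (rule lie_isomorphicI[where f = f and f' = f'])
      (use \<open>r \<noteq> 0\<close> in \<open>simp_all add: f_def f'_def iso_simps \<gg>\<^sub>3_def field_simps rr\<close>)
  then show ?thesis by (rule lie_isomorphic_sym)
qed

text \<open>Here \<open>e\<^sub>1 = e\<close>, \<open>e\<^sub>2 = f\<close>,
  \<open>e\<^sub>4 = -A/a\<close>, \<open>e\<^sub>5 = \<xi>\<close>. Since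
  \<open>[e, f] = -aB + 2\<xi>\<close> must equal \<open>e\<^sub>3 - e\<^sub>5\<close>, this forces
  \<open>e\<^sub>3 = -aB + 3\<xi>\<close>.\<close>

lemma normal_iso_g5:
  assumes "a \<noteq> 0"
  shows "normal_bracket a 0 0 (a/2) (a/2) 0 (a/2) \<simeq>\<^sub>L \<gg>\<^sub>5"
proof -
  have "\<gg>\<^sub>5 \<simeq>\<^sub>L normal_bracket a 0 0 (a/2) (a/2) 0 (a/2)"
    by (rule lie_isomorphicI[where
          f = "\<lambda>x. vector [- x$4 / a, - a * x$3, x$1, x$2, 3 * x$3 + x$5]"
        and f' = "\<lambda>x. vector [x$3, x$4, - x$2 / a, - a * x$1, x$5 + 3 * x$2 / a]"])
      (use assms in \<open>simp_all add: iso_simps \<gg>\<^sub>5_def field_simps\<close>)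
  then show ?thesis by (rule lie_isomorphic_sym)
qed

lemma normal_iso_g7:
  assumes "a \<noteq> 0" "p \<noteq> 0"
  shows "normal_bracket a 0 0 (a/2) (a/2) p (a/2) \<simeq>\<^sub>L \<gg>\<^sub>7 (\<bar>a\<bar> / \<bar>p\<bar>)"
proof -
  define \<delta> where "\<delta> = \<bar>a\<bar> / \<bar>p\<bar>"
  \<comment> \<open>The choice \<open>e\<^sub>4 = sA\<close> makes \<open>ad e\<^sub>4\<close> act
    on the plane of \<open>e\<close> and \<open>f\<close> with real part \<open>\<delta>/2\<close>
    and rotation speed \<open>u = \<plusminus>1\<close>. Taking \<open>e\<^sub>2 = uf\<close>
    corrects the sense of rotation, and
    \<open>[e\<^sub>1, e\<^sub>2] = e\<^sub>3 - e\<^sub>5\<close> then forces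
    \<open>e\<^sub>3 = -auB + (2u + 1)\<xi>\<close>.\<close>
  define s where "s = - \<delta> / a"
  define u where "u = - s * p"
  have "\<delta> \<noteq> 0" "s \<noteq> 0" using assms by (auto simp: \<delta>_def s_def)
  have "u = 1 \<or> u = - 1" using assms by (auto simp: u_def s_def \<delta>_def abs_if)
  have a: "a = - \<delta> / s" and p: "p = - u / s"
    using assms \<open>s \<noteq> 0\<close> \<open>\<delta> \<noteq> 0\<close> by (auto simp: s_def u_def)
  have "\<gg>\<^sub>7 \<delta> \<simeq>\<^sub>L normal_bracket a 0 0 (a/2) (a/2) p (a/2)"
    by (rule lie_isomorphicI[where
          f = "\<lambda>x. vector [s * x$4, - a * u * x$3, x$1, u * x$2, (2 * u + 1) * x$3 + x$5]"
        and f' = "\<lambda>x. vector [x$3, u * x$4, - u * x$2 / a, x$1 / s, x$5 + (2 * u + 1) * u * x$2 / a]"])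
      (use \<open>\<delta> \<noteq> 0\<close> \<open>s \<noteq> 0\<close> \<open>u = 1 \<or> u = - 1\<close> in
        \<open>auto simp: a p iso_simps \<gg>\<^sub>7_def field_simps\<close>)
  then show ?thesis unfolding \<delta>_def by (rule lie_isomorphic_sym)
qed

lemma normal_iso_g4:
  assumes "a \<noteq> 0"
  shows "normal_bracket a 0 0 0 a 0 a \<simeq>\<^sub>L \<gg>\<^sub>4"
proof -
  \<comment> \<open>\<open>e\<^sub>1, e\<^sub>3 = -(A \<plusminus> e)/2a\<close>, \<open>e\<^sub>2 - e\<^sub>5, e\<^sub>4 - e\<^sub>5 = aB - 2\<xi> \<plusminus> af\<close>, \<open>e\<^sub>5 = \<xi>\<close>\<close>
  have "\<gg>\<^sub>4 \<simeq>\<^sub>L normal_bracket a 0 0 0 a 0 a"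
    by (rule lie_isomorphicI[where
          f = "\<lambda>x. vector [- (x$1 + x$3) / (2 * a), a * (x$2 + x$4), - (x$1 - x$3) / (2 * a),
            a * (x$2 - x$4), x$5 - x$2 - x$4]"
        and f' = "\<lambda>x. vector [- a * (x$1 + x$3), (x$2 + x$4) / (2 * a), - a * (x$1 - x$3),
            (x$2 - x$4) / (2 * a), x$5 + x$2 / a]"])
      (use assms in \<open>simp_all add: iso_simps \<gg>\<^sub>4_def field_simps\<close>)
  then show ?thesis by (rule lie_isomorphic_sym)
qed

text \<open>A quarter turn in the plane of \<open>e\<close> and \<open>f\<close> interchanges
  \<open>c1\<close> and \<open>c2\<close>.\<close>

lemma normal_iso_swap: "normal_bracket a 0 0 a 0 0 a \<simeq>\<^sub>L normal_bracket a 0 0 0 a 0 a"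
  by (rule lie_isomorphicI[where f = "\<lambda>x. vector [x$1, x$2, - x$4, x$3, x$5]"
        and f' = "\<lambda>x. vector [x$1, x$2, x$4, - x$3, x$5]"])
    (simp_all add: iso_simps field_simps)

text \<open>\<open>J\<close> lists components of the Jacobi identity; \<open>R\<close> lists
  \<open>Ric(A, f) = Ric(A, e) = 0\<close> and the equality of \<open>Ric(e, e)\<close> and
  \<open>Ric(f, f)\<close> with \<open>Ric(A, A)\<close>. Combining them makes
  \<open>a * (a + q)\<close> the squared norm of the shape operator, so the cases are S = 0 and
  \<open>a + q \<noteq> 0\<close>, where the equations factor.\<close>

lemma normal_parameters:
  fixes a :: real
  assumes J: "p * (c1 - c2) = 2 * b1 * b2"
    "a * (q - c1) - 2 * b2\<^sup>2 - c1\<^sup>2 + c1 * c2 + c1 * q - c2 * q = 0"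
    "a * (c2 - q) + 2 * b1\<^sup>2 + c2\<^sup>2 - c1 * c2 + c1 * q - c2 * q = 0"
    "a * (c1 + c2) = 2 * b1\<^sup>2 + 2 * b2\<^sup>2 + (c1 + c2)\<^sup>2"
    and R: "b1 * (a + q) = 0" "b2 * (a + q) = 0"
    "a * c1 + 2 * b2\<^sup>2 + c1\<^sup>2 + c1 * c2 + 2 * c2 * q = a\<^sup>2 + 2 * b1\<^sup>2 + 2 * b2\<^sup>2 + c1\<^sup>2 + c2\<^sup>2"
    "a * c2 + 2 * b1\<^sup>2 + c2\<^sup>2 + c1 * c2 + 2 * c1 * q = a\<^sup>2 + 2 * b1\<^sup>2 + 2 * b2\<^sup>2 + c1\<^sup>2 + c2\<^sup>2"
  shows "a = 0 \<and> b1 = 0 \<and> b2 = 0 \<and> c1 = 0 \<and> c2 = 0 \<or>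
    a \<noteq> 0 \<and> b1 = 0 \<and> b2 = 0 \<and>
      (c1 = a / 2 \<and> c2 = a / 2 \<and> q = a / 2 \<or> p = 0 \<and> q = a \<and> (c1 = 0 \<and> c2 = a \<or> c1 = a \<and> c2 = 0))"
proof -
  have aq: "a * q = 2 * b1\<^sup>2 + 2 * b2\<^sup>2 + c1\<^sup>2 + c2\<^sup>2"
    using J(2-4) by (simp add: algebra_simps power2_eq_square)
  have norm: "a * (a + q) = a\<^sup>2 + 2 * b1\<^sup>2 + 2 * b2\<^sup>2 + c1\<^sup>2 + c2\<^sup>2"
    using aq by (simp add: algebra_simps power2_eq_square)
  \<comment> \<open>Add \<open>R(3)\<close> and \<open>R(4)\<close> and eliminate the squares by
    \<open>aq\<close> and \<open>J(4)\<close>.\<close>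
  have ac: "(a + q) * (a - (c1 + c2)) = 0"
    using aq R(3,4) J(4) by (simp add: algebra_simps power2_eq_square)
  have zero: "a = 0 \<and> b1 = 0 \<and> b2 = 0 \<and> c1 = 0 \<and> c2 = 0" if "a * (a + q) = 0"
  proof -
    have "a\<^sup>2 + 2 * b1\<^sup>2 + 2 * b2\<^sup>2 + c1\<^sup>2 + c2\<^sup>2 = 0" using that norm by simp
    then have "a\<^sup>2 = 0" "b1\<^sup>2 = 0" "b2\<^sup>2 = 0" "c1\<^sup>2 = 0" "c2\<^sup>2 = 0"
      using zero_le_power2[of a] zero_le_power2[of b1] zero_le_power2[of b2] zero_le_power2[of c1]
        zero_le_power2[of c2] by linarith+
    then show ?thesis by simp
  qed
  show ?thesis
  proof (cases "a * (a + q) = 0")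
    case True
    then show ?thesis using zero by blast
  next
    case False
    then have "a \<noteq> 0" and b: "b1 = 0" "b2 = 0" and a: "a = c1 + c2" using R(1,2) ac by auto
    \<comment> \<open>With \<open>a = c1 + c2\<close> two Jacobi equations factor. As
      \<open>a \<noteq> 0\<close>, either both of \<open>c1\<close>, \<open>c2\<close> equal
      \<open>q\<close>, or exactly one vanishes and \<open>J(1)\<close> gives
      \<open>p = 0\<close>.\<close>
    have "c1 * (q - c1) = 0" "c2 * (q - c2) = 0"
      using J(2,3) unfolding a b by (auto simp: algebra_simps power2_eq_square)
    moreover have "p * (c1 - c2) = 0" using J(1) b by simp
    ultimately show ?thesis using \<open>a \<noteq> 0\<close> a b by auto
  qed
qed

text \<open>For S = 0 the algebra is \<open>\<gg>\<^sub>1\<close> or \<open>\<gg>\<^sub>3\<close>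
  according to whether \<open>p = q = 0\<close>; for \<open>c1 = c2 = a / 2\<close> it is
  \<open>\<gg>\<^sub>5\<close> if \<open>p = 0\<close> and some
  \<open>\<gg>\<^sub>7 \<delta>\<close> otherwise; the last two cases are
  \<open>\<gg>\<^sub>4\<close> up to the quarter turn.\<close>

lemma normal_bracket_models:
  assumes "a = 0 \<and> b1 = 0 \<and> b2 = 0 \<and> c1 = 0 \<and> c2 = 0 \<or>
    a \<noteq> 0 \<and> b1 = 0 \<and> b2 = 0 \<and>
      (c1 = a / 2 \<and> c2 = a / 2 \<and> q = a / 2 \<or> p = 0 \<and> q = a \<and> (c1 = 0 \<and> c2 = a \<or> c1 = a \<and> c2 = 0))"
    and iso: "normal_bracket a b1 b2 c1 c2 p q \<simeq>\<^sub>L br"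
  shows "br \<simeq>\<^sub>L \<gg>\<^sub>1 \<or> br \<simeq>\<^sub>L \<gg>\<^sub>3 \<or> br \<simeq>\<^sub>L \<gg>\<^sub>4 \<or> br \<simeq>\<^sub>L \<gg>\<^sub>5 \<or> (\<exists>\<delta>>0. br \<simeq>\<^sub>L \<gg>\<^sub>7 \<delta>)"
proof -
  have tr: "br \<simeq>\<^sub>L br'" if "normal_bracket a b1 b2 c1 c2 p q \<simeq>\<^sub>L br'" for br' :: "real^5 \<Rightarrow> real^5 \<Rightarrow> real^5"
    using lie_isomorphic_trans[OF lie_isomorphic_sym[OF iso] that] .
  from assms(1) show ?thesis
  proof (elim disjE conjE, goal_cases)
    case 1
    show ?thesis
    proof (cases "p = 0 \<and> q = 0")
      case True
      with 1 show ?thesis using tr normal_iso_g1 by simp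
    next
      case False
      with 1 show ?thesis using tr normal_iso_g3[of p q] by simp
    qed
  next
    case 2
    show ?thesis
    proof (cases "p = 0")
      case True
      show ?thesis using tr normal_iso_g5[OF 2(1)] unfolding 2(2-) True by blast
    next
      case False
      have "br \<simeq>\<^sub>L \<gg>\<^sub>7 (\<bar>a\<bar> / \<bar>p\<bar>)" using tr normal_iso_g7[OF 2(1) False] unfolding 2(2-) by blast
      moreover have "\<bar>a\<bar> / \<bar>p\<bar> > 0" using 2(1) False by simp
      ultimately show ?thesis by blast
    qed
  next
    case 3
    then show ?thesis using tr normal_iso_g4[of a] by simp
  next
    case 4
    then show ?thesis using tr lie_isomorphic_trans[OF normal_iso_swap normal_iso_g4, of a] by simp
  qed
qed

section \<open>Existence of the structures on the listed algebras\<close>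

lemma lin_trace_5:
  assumes "linear f"
  shows "lin_trace (f :: real^5 \<Rightarrow> real^5) = f (axis 1 1) $ 1 + f (axis 2 1) $ 2 + f (axis 3 1) $ 3
    + f (axis 4 1) $ 4 + f (axis 5 1) $ 5"
  using lin_trace_cart[OF assms] by (simp add: sum_5)

lemma linear_ad:
  assumes "lie_algebra br"
  shows "linear (br x)" "linear (\<lambda>y. br x (br x y))"
proof -
  show "linear (br x)" using assms by (auto simp: lie_algebra_def bilinear_def)
  from linear_compose[OF this this] show "linear (\<lambda>y. br x (br x y))" by (simp add: o_def)
qed

lemma dim_eq_of_bij_linear:
  fixes f :: "'a::real_vector \<Rightarrow> 'b::real_vector"
  assumes "linear f" "bij f"
  shows "dim (UNIV :: 'a set) = dim (UNIV :: 'b set)"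
proof -
  obtain B :: "'a set" where B: "independent B" "span B = UNIV"
    using real_vector.basis_exists[of UNIV] by (metis UNIV_I subsetI subset_antisym)
  have "independent (f ` B)" "span (f ` B) = UNIV"
    using B assms linear_independent_injective_image[OF assms(1) B(1)] inj_on_subset[of f UNIV]
    by (auto simp: linear_span_image bij_def)
  moreover have "card (f ` B) = card B"
    using assms(2) by (intro card_image) (auto simp: bij_def intro: inj_on_subset)
  ultimately show ?thesis
    using real_vector.dim_eq_card[of B UNIV] real_vector.dim_eq_card[of "f ` B" UNIV] B by simp
qed

text \<open>The standard structure of the normal bracket is pulled back to \<open>br\<close>.
  \<open>E\<close> is the list of Einstein equations of \<open>eta_einstein_normal\<close> after
  cancelling equal terms; the preimage of \<xi> is the nonzero central element.\<close>

lemma normal_bracket_realization: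
  fixes br :: "'a::real_vector \<Rightarrow> 'a \<Rightarrow> 'a"
  assumes "lie_algebra \<kk>" "normal_bracket a 0 0 c1 c2 p q \<simeq>\<^sub>L \<kk>" "br \<simeq>\<^sub>L \<kk>"
    and E: "a * (c1 + c2) = c1\<^sup>2 + c2\<^sup>2 + 2 * c1 * c2"
    "a\<^sup>2 + c2\<^sup>2 = a * c1 + c1 * c2 + 2 * c2 * q" "a\<^sup>2 + c1\<^sup>2 = a * c2 + c1 * c2 + 2 * c1 * q"
    "p * (c1 - c2) = 0"
  shows "lie_algebra br \<and> dim (UNIV :: 'a set) = 5 \<and> lie_center br \<noteq> {0} \<and>
    (\<exists>\<phi> \<xi> \<eta> g. sasakian br \<phi> \<xi> \<eta> g \<and> eta_einstein br \<eta> g)"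
proof -
  let ?n = "normal_bracket a 0 0 c1 c2 p q"
  have n: "lie_algebra ?n"
    using assms(1,2) lie_algebra_pullback[of _ ?n \<kk>] unfolding lie_isomorphic_def bij_def by blast
  have std: "sasakian_eta_einstein ?n std_phi (axis 5 1) (\<lambda>x. x $ 5) inner"
    unfolding sasakian_eta_einstein_def using sasakian_normal[OF n] eta_einstein_normal[OF n] E by simp
  have "br \<simeq>\<^sub>L ?n" using assms(2,3) lie_isomorphic_sym lie_isomorphic_trans by blast
  then obtain f where f: "linear f" "bij f" "\<And>x y. f (br x y) = ?n (f x) (f y)"
    unfolding lie_isomorphic_def by blast
  note inj = bij_is_inj[OF f(2)] and surj = surj_f_inv_f[OF bij_is_surj[OF f(2)]]
  have dim: "dim (UNIV :: 'a set) = 5"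
    using dim_eq_of_bij_linear[OF f(1,2)] by simp
  have "sasakian_eta_einstein br (\<lambda>x. inv f (std_phi (f x))) (inv f (axis 5 1)) (\<lambda>x. f x $ 5)
      (\<lambda>x y. f x \<bullet> f y)"
    by (rule sasakian_eta_einstein_pullback[where F = f and br = ?n and br' = br and \<phi> = std_phi
          and \<eta> = "\<lambda>x. x $ 5" and g = inner and \<xi> = "axis 5 1"])
      (use dim f std in \<open>simp_all only: dim_real5 surj\<close>)
  moreover have "inv f (axis 5 1) \<in> lie_center br"
  proof -
    have "br (inv f (axis 5 1)) x = 0" for x
      by (rule injD[OF inj]) (simp add: f(3) surj linear_0[OF f(1)] normal_bracket_def e2_def axis_5
        vec_eq_iff forall_5 vector_5)
    then show ?thesis by (simp add: lie_center_def)
  qed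
  moreover have "inv f (axis 5 1) \<noteq> 0"
    using surj[of "axis 5 1"] linear_0[OF f(1)] by (metis axis_eq_0_iff zero_neq_one)
  moreover have "lie_algebra br" by (rule lie_algebra_pullback[OF f(1) inj f(3) n])
  ultimately show ?thesis using dim unfolding sasakian_eta_einstein_def by blast
qed

lemma sasakian_eta_einstein_exists:
  fixes br :: "'a::real_vector \<Rightarrow> 'a \<Rightarrow> 'a"
  assumes "br \<simeq>\<^sub>L \<gg>\<^sub>1 \<or> br \<simeq>\<^sub>L \<gg>\<^sub>3 \<or> br \<simeq>\<^sub>L \<gg>\<^sub>4 \<or> br \<simeq>\<^sub>L \<gg>\<^sub>5 \<or> (\<exists>\<delta>>0. br \<simeq>\<^sub>L \<gg>\<^sub>7 \<delta>)"
  shows "lie_algebra br \<and> dim (UNIV :: 'a set) = 5 \<and> lie_center br \<noteq> {0} \<and>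
    (\<exists>\<phi> \<xi> \<eta> g. sasakian br \<phi> \<xi> \<eta> g \<and> eta_einstein br \<eta> g)"
proof -
  from assms consider "br \<simeq>\<^sub>L \<gg>\<^sub>1" | "br \<simeq>\<^sub>L \<gg>\<^sub>3" | "br \<simeq>\<^sub>L \<gg>\<^sub>4" | "br \<simeq>\<^sub>L \<gg>\<^sub>5"
    | \<delta> where "\<delta> > 0" "br \<simeq>\<^sub>L \<gg>\<^sub>7 \<delta>" by blast
  then show ?thesis
  proof cases
    case 1
    show ?thesis by (rule normal_bracket_realization[OF lie_algebra_g1 normal_iso_g1 1]) simp_all
  next
    case 2
    show ?thesis
      by (rule normal_bracket_realization[OF lie_algebra_g3 normal_iso_g3[of 1 0] 2]) simp_all
  next
    case 3
    show ?thesis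
      by (rule normal_bracket_realization[OF lie_algebra_g4 normal_iso_g4[of 1] 3]) simp_all
  next
    case 4
    show ?thesis
      by (rule normal_bracket_realization[OF lie_algebra_g5 normal_iso_g5[of 1] 4])
        (simp_all add: power2_eq_square)
  next
    case (5 \<delta>)
    \<comment> \<open>Taking \<open>a = \<delta>\<close> and \<open>p = 1\<close> realizes every
      prescribed ratio of \<open>a\<close> to \<open>p\<close>.\<close>
    have "normal_bracket \<delta> 0 0 (\<delta>/2) (\<delta>/2) 1 (\<delta>/2) \<simeq>\<^sub>L \<gg>\<^sub>7 \<delta>"
      using normal_iso_g7[of \<delta> 1] 5(1) by simp
    then show ?thesis
      by (rule normal_bracket_realization[OF lie_algebra_g7 _ 5(2)])
        (simp_all add: power2_eq_square algebra_simps)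
  qed
qed

section \<open>Adapted frames\<close>

lemma linear_expand_5:
  fixes f :: "real^5 \<Rightarrow> 'a::real_vector"
  assumes "linear f"
  shows "f v = v$1 *\<^sub>R f (axis 1 1) + v$2 *\<^sub>R f (axis 2 1) + v$3 *\<^sub>R f (axis 3 1)
    + v$4 *\<^sub>R f (axis 4 1) + v$5 *\<^sub>R f (axis 5 1)"
proof -
  have v: "v = v$1 *\<^sub>R axis 1 1 + v$2 *\<^sub>R axis 2 1 + v$3 *\<^sub>R axis 3 1 + v$4 *\<^sub>R axis 4 1 + v$5 *\<^sub>R axis 5 1"
    by (simp add: vec_eq_iff forall_5 axis_def)
  show ?thesis
    by (subst v) (simp only: linear_add[OF assms] linear_cmul[OF assms])
qed

lemma alternating_antisym:
  assumes "bilinear h" "\<And>x. h x x = 0"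
  shows "h y x = - h x y"
  using assms(2)[of "x + y"] assms(2)[of x] assms(2)[of y]
  by (simp add: bilinear_ladd[OF assms(1)] bilinear_radd[OF assms(1)] add_eq_0_iff)

lemma alternating_expand_5:
  fixes h :: "real^5 \<Rightarrow> real^5 \<Rightarrow> real"
  assumes h: "bilinear h" "\<And>x. h x x = 0"
  shows "h x y = e2 1 2 x y * h (axis 1 1) (axis 2 1) + e2 1 3 x y * h (axis 1 1) (axis 3 1)
    + e2 1 4 x y * h (axis 1 1) (axis 4 1) + e2 1 5 x y * h (axis 1 1) (axis 5 1)
    + e2 2 3 x y * h (axis 2 1) (axis 3 1) + e2 2 4 x y * h (axis 2 1) (axis 4 1)
    + e2 2 5 x y * h (axis 2 1) (axis 5 1) + e2 3 4 x y * h (axis 3 1) (axis 4 1)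
    + e2 3 5 x y * h (axis 3 1) (axis 5 1) + e2 4 5 x y * h (axis 4 1) (axis 5 1)"
proof -
  have l: "linear (\<lambda>x. h x y)" and r: "linear (h x)" for x y
    using h by (auto simp: bilinear_def)
  note s = alternating_antisym[OF h]
  note swap = s[of "axis 2 1" "axis 1 1"] s[of "axis 3 1" "axis 1 1"] s[of "axis 3 1" "axis 2 1"]
    s[of "axis 4 1" "axis 1 1"] s[of "axis 4 1" "axis 2 1"] s[of "axis 4 1" "axis 3 1"]
    s[of "axis 5 1" "axis 1 1"] s[of "axis 5 1" "axis 2 1"] s[of "axis 5 1" "axis 3 1"]
    s[of "axis 5 1" "axis 4 1"]
  show ?thesis
    unfolding linear_expand_5[OF l, of x y] linear_expand_5[OF r, of "axis i 1" y for i]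
      swap h(2) e2_def real_scaleR_def
    by algebra
qed

text \<open>All Sasakian data are frozen on \<open>real^5\<close> and only the bracket varies.
  Centrality of \<xi> is what a nontrivial center provides, by \<open>center_xi\<close>.\<close>

definition std_structure :: "(real^5 \<Rightarrow> real^5 \<Rightarrow> real^5) \<Rightarrow> bool" where
  "std_structure br \<longleftrightarrow> sasakian_eta_einstein br std_phi (axis 5 1) (\<lambda>x. x $ 5) inner
     \<and> (\<forall>x. br (axis 5 1) x = 0)"

context
  fixes br :: "'a::real_vector \<Rightarrow> 'a \<Rightarrow> 'a" and \<phi> \<xi> \<eta> g
  assumes sas: "sasakian br \<phi> \<xi> \<eta> g"
begin

lemma sasakian_lie_algebra: "lie_algebra br" and sasakian_inner: "inner_product_form g"
  and lin_phi: "linear \<phi>" and lin_eta: "linear \<eta>"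
  and phi_phi: "\<phi> (\<phi> x) = - x + \<eta> x *\<^sub>R \<xi>" and eta_xi: "\<eta> \<xi> = 1"
  and g_phi_phi: "g (\<phi> x) (\<phi> y) = g x y - \<eta> x * \<eta> y" and d_eta: "- \<eta> (br x y) = 2 * g x (\<phi> y)"
  using sas by (auto simp: sasakian_def almost_contact_metric_def ce_d_def fundamental_form_def)

lemma g_bilinear: "bilinear g" and g_sym: "g x y = g y x" and g_pos: "x \<noteq> 0 \<Longrightarrow> g x x > 0"
  using sasakian_inner by (auto simp: inner_product_form_def)

lemma phi_xi: "\<phi> \<xi> = 0"
proof -
  have "\<phi> (\<phi> \<xi>) = 0" by (simp add: phi_phi eta_xi)
  \<comment> \<open>Cubing shows that \<open>\<phi> \<xi>\<close> is a multiple of \<xi>; squaring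
    then shows that the factor or the vector is zero.\<close>
  then have "\<phi> (\<phi> (\<phi> \<xi>)) = 0" by (simp only: linear_0[OF lin_phi])
  then have 1: "\<phi> \<xi> = \<eta> (\<phi> \<xi>) *\<^sub>R \<xi>" using phi_phi[of "\<phi> \<xi>"] by simp
  then have "\<phi> (\<phi> \<xi>) = \<eta> (\<phi> \<xi>) *\<^sub>R \<phi> \<xi>" by (metis linear_cmul[OF lin_phi])
  with \<open>\<phi> (\<phi> \<xi>) = 0\<close> 1 show ?thesis by auto
qed

lemma eta_phi: "\<eta> (\<phi> x) = 0"
proof -
  \<comment> \<open>Both sides are the cube of \<phi> at \<open>x\<close>, with the square applied
    outside and inside.\<close>
  have "- \<phi> x + \<eta> (\<phi> x) *\<^sub>R \<xi> = - \<phi> x"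
    using phi_phi[of "\<phi> x"]
    by (simp add: phi_phi linear_diff[OF lin_phi] linear_cmul[OF lin_phi] phi_xi)
  moreover have "\<xi> \<noteq> 0" using eta_xi linear_0[OF lin_eta] by auto
  ultimately show ?thesis by simp
qed

lemma g_xi: "g x \<xi> = \<eta> x"
  using g_phi_phi[of x \<xi>] by (simp add: phi_xi eta_xi bilinear_rzero[OF g_bilinear])

lemma g_phi_skew: "g (\<phi> x) y = - g x (\<phi> y)"
  using g_phi_phi[of x "\<phi> y"]
  by (simp add: phi_phi eta_phi g_xi bilinear_rsub[OF g_bilinear] bilinear_rmul[OF g_bilinear])

lemma g_phi_self: "g x (\<phi> x) = 0"
  using g_phi_skew[of x x] g_sym[of x "\<phi> x"] by simp

text \<open>For central \<open>z\<close>, the equation \<open>d\<eta>(z, \<phi> z) = 0\<close> says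
  that the part of \<open>z\<close> orthogonal to \<xi> has norm zero.\<close>

lemma center_xi:
  assumes "lie_center br \<noteq> {0}"
  shows "br \<xi> x = 0"
proof -
  have b: "bilinear br" using sasakian_lie_algebra by (simp add: lie_algebra_def)
  obtain z where "z \<noteq> 0" and z: "br z x = 0" for x
  proof -
    have "0 \<in> lie_center br" by (simp add: lie_center_def bilinear_lzero[OF b])
    with assms that show thesis unfolding lie_center_def by blast
  qed
  have "g z (\<phi> (\<phi> z)) = 0" using d_eta[of z "\<phi> z"] by (simp add: z linear_0[OF lin_eta])
  then have "g (z - \<eta> z *\<^sub>R \<xi>) (z - \<eta> z *\<^sub>R \<xi>) = 0"
    using g_sym[of \<xi> z]
    by (simp add: phi_phi g_xi eta_xi bilinear_rmul[OF g_bilinear] bilinear_lmul[OF g_bilinear] bilinear_rsub[OF g_bilinear]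
        bilinear_lsub[OF g_bilinear] linear_diff[OF lin_eta] linear_cmul[OF lin_eta])
  then have zz: "z = \<eta> z *\<^sub>R \<xi>" using g_pos[of "z - \<eta> z *\<^sub>R \<xi>"] by force
  then have "\<eta> z \<noteq> 0" using \<open>z \<noteq> 0\<close> by auto
  moreover have "\<eta> z *\<^sub>R br \<xi> x = 0" using z[of x] zz by (metis bilinear_lmul[OF b])
  ultimately show ?thesis by simp
qed

text \<open>One Gram-Schmidt step, starting from a vector outside the span of
  \<open>S\<close>.\<close>

lemma unit_orthogonal_exists:
  assumes "finite S" "card S < dim (UNIV :: 'a set)"
    and S: "\<And>u. u \<in> S \<Longrightarrow> g u u = 1" "\<And>u v. u \<in> S \<Longrightarrow> v \<in> S \<Longrightarrow> u \<noteq> v \<Longrightarrow> g u v = 0"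
  shows "\<exists>v. g v v = 1 \<and> (\<forall>u\<in>S. g v u = 0)"
proof -
  note gl = bilinear_ladd[OF g_bilinear] bilinear_lmul[OF g_bilinear] bilinear_lsub[OF g_bilinear]
  have lin: "linear (\<lambda>x. g x y)" for y using g_bilinear by (simp add: bilinear_def)
  have "span S \<noteq> UNIV"
    using real_vector.dim_le_card[of UNIV S] assms(1,2) by auto
  then obtain x where x: "x \<notin> span S" by blast
  define w where "w = x - (\<Sum>u\<in>S. g x u *\<^sub>R u)"
  have "w \<noteq> 0"
  proof
    assume "w = 0"
    then have "x = (\<Sum>u\<in>S. g x u *\<^sub>R u)" by (simp add: w_def)
    also have "\<dots> \<in> span S" by (intro span_sum span_scale span_base)
    finally show False using x by simp
  qed
  have "g w v = 0" if "v \<in> S" for v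
  proof -
    have "g w v = g x v - (\<Sum>u\<in>S. g x u * g u v)"
      by (simp add: w_def gl linear_sum[OF lin])
    also have "(\<Sum>u\<in>S. g x u * g u v) = (\<Sum>u\<in>S. if u = v then g x v else 0)"
      by (rule sum.cong) (use S that in auto)
    finally show ?thesis using that assms(1) by simp
  qed
  moreover define r where "r = sqrt (g w w)"
  moreover have "r \<noteq> 0" "r * r = g w w" using g_pos[OF \<open>w \<noteq> 0\<close>] by (auto simp: r_def)
  ultimately have "g (w /\<^sub>R r) (w /\<^sub>R r) = 1 \<and> (\<forall>u\<in>S. g (w /\<^sub>R r) u = 0)"
    by (auto simp: gl bilinear_rmul[OF g_bilinear] field_simps)
  then show ?thesis by blast
qed

definition frame :: "'a \<Rightarrow> 'a \<Rightarrow> real^5 \<Rightarrow> 'a" where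
  "frame A e x = x$1 *\<^sub>R A + x$2 *\<^sub>R \<phi> A + x$3 *\<^sub>R e + x$4 *\<^sub>R \<phi> e + x$5 *\<^sub>R \<xi>"

lemma linear_frame: "linear (frame A e)"
  by (intro linearI) (simp_all add: frame_def algebra_simps)

lemma frame_axis:
  "frame A e (axis 1 1) = A" "frame A e (axis 2 1) = \<phi> A" "frame A e (axis 3 1) = e"
  "frame A e (axis 4 1) = \<phi> e" "frame A e (axis 5 1) = \<xi>"
  by (simp_all add: frame_def axis_def)

lemma frame_isometry:
  assumes A: "g A A = 1" "\<eta> A = 0" and e: "g e e = 1" "\<eta> e = 0" "g e A = 0" "g e (\<phi> A) = 0"
  shows "g (frame A e x) (frame A e y) = x \<bullet> y" and "frame A e (std_phi x) = \<phi> (frame A e x)"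
    and "\<eta> (frame A e x) = x $ 5"
proof -
  have xi: "g \<xi> z = \<eta> z" for z using g_sym[of \<xi> z] g_xi[of z] by simp
  have 1: "g A e = 0" "g (\<phi> A) e = 0"
    using e g_sym[of A e] g_sym[of "\<phi> A" e] by simp_all
  have 2: "g A (\<phi> e) = 0" "g (\<phi> e) A = 0" "g (\<phi> A) A = 0" "g (\<phi> e) e = 0"
    using g_phi_skew[of A e] g_phi_skew[of e A] 1 e by (simp_all add: g_phi_skew g_phi_self)
  have 3: "g (\<phi> A) (\<phi> e) = 0" "g (\<phi> e) (\<phi> A) = 0" "g (\<phi> A) (\<phi> A) = 1" "g (\<phi> e) (\<phi> e) = 1"
    by (simp_all add: g_phi_phi A e 1)
  note sym = xi 1 2 3
  show "g (frame A e x) (frame A e y) = x \<bullet> y"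
    by (simp add: frame_def inner_5 bilinear_ladd[OF g_bilinear] bilinear_lmul[OF g_bilinear]
        bilinear_radd[OF g_bilinear] bilinear_rmul[OF g_bilinear] A e sym g_phi_self g_xi eta_xi eta_phi
        linear_add[OF lin_eta] linear_cmul[OF lin_eta])
  show "frame A e (std_phi x) = \<phi> (frame A e x)"
    by (simp add: frame_def std_phi_def vector_5 linear_add[OF lin_phi] linear_cmul[OF lin_phi]
        phi_phi phi_xi A e)
  show "\<eta> (frame A e x) = x $ 5"
    by (simp add: frame_def linear_add[OF lin_eta] linear_cmul[OF lin_eta] A e eta_phi eta_xi)
qed

lemma bij_frame:
  assumes "dim (UNIV :: 'a set) = 5"
    and A: "g A A = 1" "\<eta> A = 0" and e: "g e e = 1" "\<eta> e = 0" "g e A = 0" "g e (\<phi> A) = 0"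
  shows "bij (frame A e)"
proof -
  have inj: "inj (frame A e)"
  proof (subst linear_injective_0[OF linear_frame], intro allI impI)
    fix x assume "frame A e x = 0"
    then have "x \<bullet> x = 0"
      using frame_isometry(1)[OF A e, of x x] by (simp add: bilinear_lzero[OF g_bilinear])
    then show "x = 0" by simp
  qed
  let ?B = "frame A e ` Basis"
  have ind: "independent ?B"
    by (rule linear_independent_injective_image[OF linear_frame independent_Basis inj_on_subset[OF inj]]) simp
  have card: "card ?B = 5"
    by (simp add: card_image[OF inj_on_subset[OF inj]])
  \<comment> \<open>A basis extending the image of the frame has five elements, as many as the
    image, so the image already spans.\<close>
  obtain C where C: "?B \<subseteq> C" "independent C" "UNIV \<subseteq> span C"
    using real_vector.maximal_independent_subset_extend[of ?B UNIV] ind by auto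
  have "card C = 5"
    using real_vector.dim_eq_card[of C UNIV] C assms(1) by auto
  then have "?B = C"
    using C(1) card card_subset_eq[of C ?B] card_ge_0_finite[of C] by simp
  then have "span ?B = UNIV" using C by auto
  then have "surj (frame A e)"
    using linear_span_image[OF linear_frame, of A e Basis] by simp
  with inj show ?thesis by (simp add: bij_def)
qed

lemma frame_std_structure:
  assumes "dim (UNIV :: 'a set) = 5" "eta_einstein br \<eta> g" "\<And>x. br \<xi> x = 0"
    and A: "g A A = 1" "\<eta> A = 0" and e: "g e e = 1" "\<eta> e = 0" "g e A = 0" "g e (\<phi> A) = 0"
  obtains br' where "std_structure br'" "\<And>x y. frame A e (br' x y) = br (frame A e x) (frame A e y)"
proof -
  let ?F = "frame A e"
  note bij = bij_frame[OF assms(1) A e] and lin = linear_frame[of A e] and iso = frame_isometry[OF A e]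
  define br' where "br' x y = inv ?F (br (?F x) (?F y))" for x y
  have hom: "?F (br' x y) = br (?F x) (?F y)" for x y
    unfolding br'_def using bij by (simp add: bij_def surj_f_inv_f)
  have "sasakian_eta_einstein br' std_phi (axis 5 1) (\<lambda>x. x $ 5) inner"
  proof (rule sasakian_eta_einstein_pullback[where F = ?F and br = br and br' = br' and \<phi> = \<phi>
        and \<phi>' = std_phi and \<eta> = \<eta> and \<eta>' = "\<lambda>x. x $ 5" and g = g and g' = inner
        and \<xi> = \<xi> and \<xi>' = "axis 5 1"])
    show "sasakian_eta_einstein br \<phi> \<xi> \<eta> g" using sas assms(2) by (simp add: sasakian_eta_einstein_def)
  qed (use assms(1) lin bij in \<open>simp_all only: hom iso frame_axis dim_real5\<close>)
  moreover have "br' (axis 5 1) x = 0" for x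
    by (rule injD[OF bij_is_inj[OF bij]]) (simp add: hom frame_axis assms(3) linear_0[OF lin])
  ultimately show thesis using that hom by (auto simp: std_structure_def)
qed

text \<open>When the dual form of \<open>A\<close> is closed, the last equation says that the
  \<open>(e, \<phi>e)\<close> entry of \<open>\<nabla>A\<close> vanishes, since the skew map
  \<open>\<nabla>\<^sub>A\<close> drops out of the sum. It is reached by rotating \<open>e\<close>
  so as to diagonalize the symmetric part of \<open>ad A\<close> on the plane orthogonal to
  \<open>A\<close>, \<open>\<phi> A\<close> and \<xi>.\<close>

lemma diagonalizing_frame:
  assumes "dim (UNIV :: 'a set) = 5" and A: "g A A = 1" "\<eta> A = 0"
  obtains e where "g e e = 1" "\<eta> e = 0" "g e A = 0" "g e (\<phi> A) = 0"
    "g (br A e) (\<phi> e) + g (br A (\<phi> e)) e = 0"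
proof -
  have AphiA: "g (\<phi> A) (\<phi> A) = 1" using A by (simp add: g_phi_phi)
  have xi: "g \<xi> z = \<eta> z" for z by (metis g_xi g_sym)
  have "\<exists>v. g v v = 1 \<and> (\<forall>u\<in>{A, \<phi> A, \<xi>}. g v u = 0)"
  proof (rule unit_orthogonal_exists)
    have "card {A, \<phi> A, \<xi>} \<le> 3" by (simp add: card_insert_if)
    then show "card {A, \<phi> A, \<xi>} < dim (UNIV :: 'a set)" using assms(1) by simp
  qed (use A AphiA g_phi_self[of A] g_phi_skew[of A A] in \<open>auto simp: xi g_xi eta_xi eta_phi\<close>)
  then obtain e0 where e0: "g e0 e0 = 1" "\<eta> e0 = 0" "g e0 A = 0" "g e0 (\<phi> A) = 0"
    by (auto simp: g_xi)
  have e0': "g (\<phi> e0) e0 = 0" "g e0 (\<phi> e0) = 0" "g (\<phi> e0) (\<phi> e0) = 1" "g (\<phi> e0) A = 0"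
    "g (\<phi> e0) (\<phi> A) = 0" "\<phi> (\<phi> e0) = - e0"
    using g_phi_self[of e0] g_phi_skew[of e0 e0] g_phi_skew[of e0 A] e0 A
    by (simp_all add: g_phi_phi phi_phi)
  define m where "m u v = g (br A u) v" for u v
  \<comment> \<open>The trace-free symmetric part turns at twice the speed of \<open>e\<close>, so
    its polar angle has to be halved.\<close>
  obtain r \<theta> where "m e0 e0 - m (\<phi> e0) (\<phi> e0) = r * cos \<theta>" "m e0 (\<phi> e0) + m (\<phi> e0) e0 = r * sin \<theta>"
    using polar_Ex by blast
  then have pol: "m (\<phi> e0) (\<phi> e0) = m e0 e0 - r * cos \<theta>" "m (\<phi> e0) e0 = r * sin \<theta> - m e0 (\<phi> e0)"
    by simp_all
  define c s where "c = cos (\<theta> / 2)" "s = sin (\<theta> / 2)"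
  have cs: "c * c + s * s = 1" by (simp add: c_s_def flip: power2_eq_square)
  have double: "cos \<theta> = c * c - s * s" "sin \<theta> = 2 * s * c"
    using cos_double[of "\<theta> / 2"] sin_double[of "\<theta> / 2"] by (simp_all add: c_s_def power2_eq_square)
  define e where "e = c *\<^sub>R e0 + s *\<^sub>R \<phi> e0"
  have phi_e: "\<phi> e = c *\<^sub>R \<phi> e0 - s *\<^sub>R e0"
    by (simp add: e_def linear_add[OF lin_phi] linear_cmul[OF lin_phi] e0')
  have b: "bilinear br" using sasakian_lie_algebra by (simp add: lie_algebra_def)
  note bil = bilinear_ladd[OF g_bilinear] bilinear_lmul[OF g_bilinear] bilinear_radd[OF g_bilinear]
    bilinear_rmul[OF g_bilinear] bilinear_lsub[OF g_bilinear] bilinear_rsub[OF g_bilinear]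
    bilinear_radd[OF b] bilinear_rmul[OF b] bilinear_rsub[OF b]
  show thesis
  proof (rule that[of e])
    show "g e e = 1" using cs by (simp add: e_def bil e0 e0')
    show "\<eta> e = 0" by (simp add: e_def linear_add[OF lin_eta] linear_cmul[OF lin_eta] e0 eta_phi)
    show "g e A = 0" "g e (\<phi> A) = 0" by (simp_all add: e_def bil e0 e0')
    have "g (br A e) (\<phi> e) + g (br A (\<phi> e)) e
        = (c * c - s * s) * (m e0 (\<phi> e0) + m (\<phi> e0) e0) + 2 * s * c * (m (\<phi> e0) (\<phi> e0) - m e0 e0)"
      unfolding phi_e unfolding e_def by (simp add: bil m_def algebra_simps)
    also have "\<dots> = 0" unfolding pol double by (simp add: algebra_simps)
    finally show "g (br A e) (\<phi> e) + g (br A (\<phi> e)) e = 0" .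
  qed
qed

end

section \<open>Closed forms and the normal form\<close>

lemma lin_trace_swap:
  fixes f h :: "real^'n \<Rightarrow> real^'n"
  assumes "linear f" "linear h"
  shows "lin_trace (f \<circ> h) = lin_trace (h \<circ> f)"
proof -
  have t: "lin_trace k = trace (matrix k)" if "linear k" for k :: "real^'n \<Rightarrow> real^'n"
    by (simp add: lin_trace_cart[OF that] trace_def matrix_def)
  show ?thesis
    unfolding t[OF linear_compose[OF assms(1) assms(2)]] t[OF linear_compose[OF assms(2) assms(1)]]
      matrix_compose[OF assms] matrix_compose[OF assms(2,1)]
    by (rule trace_mul_sym)
qed

text \<open>By the Jacobi identity \<open>ad [x, y]\<close> is the commutator of \<open>ad x\<close>
  and \<open>ad y\<close>.\<close>

lemma lin_trace_ad_bracket: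
  fixes br :: "real^'n \<Rightarrow> real^'n \<Rightarrow> real^'n"
  assumes L: "lie_algebra br"
  shows "lin_trace (br (br x y)) = 0"
proof -
  have b: "bilinear br" using L by (simp add: lie_algebra_def)
  have l: "linear (br x)" for x using b by (simp add: bilinear_def)
  have e: "br (br x y) z = br x (br y z) - br y (br x z)" for z
  proof -
    have a: "br x x = 0" for x using L by (simp add: lie_algebra_def)
    have "br x (br y z) + br y (br z x) + br z (br x y) = 0" using L by (simp add: lie_algebra_def)
    then show ?thesis
      unfolding alternating_antisym[OF b a, of z x] alternating_antisym[OF b a, of z "br x y"]
      by (simp add: bilinear_rneg[OF b] algebra_simps)
  qed
  have lc: "linear (br x \<circ> br y)" for x y by (intro linear_compose l)
  have "lin_trace (br (br x y)) = lin_trace (br x \<circ> br y) - lin_trace (br y \<circ> br x)"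
    by (simp add: lin_trace_cart[OF l] lin_trace_cart[OF lc] e sum_subtractf)
  then show ?thesis using lin_trace_swap[OF l l, of x y] by simp
qed

text \<open>The identity \<open>d\<beta> \<and> \<gamma> = \<beta> \<and> d\<gamma> + d(\<beta> \<and> \<gamma>)\<close> for a \<open>1\<close>-form \<open>\<beta>\<close> and a \<open>2\<close>-form
  \<open>\<gamma>\<close> in dimension \<open>4\<close>; the first four lines of the right-hand side are \<open>d(\<beta> \<and> \<gamma>)\<close>, which vanishes
  for a unimodular algebra.\<close>

lemma wedge_differential_identity:
  fixes A1 :: real
  shows "(A1 * c121 + A2 * c122 + A3 * c123 + A4 * c124) * F34
    + F12 * (A1 * c341 + A2 * c342 + A3 * c343 + A4 * c344)
    - (A1 * c131 + A2 * c132 + A3 * c133 + A4 * c134) * F24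
    - F13 * (A1 * c241 + A2 * c242 + A3 * c243 + A4 * c244)
    + (A1 * c141 + A2 * c142 + A3 * c143 + A4 * c144) * F23
    + F14 * (A1 * c231 + A2 * c232 + A3 * c233 + A4 * c234) =
      (c122 + c133 + c144) * (A2 * F34 - A3 * F24 + A4 * F23)
    - (- c121 + c233 + c244) * (A1 * F34 - A3 * F14 + A4 * F13)
    + (- c131 - c232 + c344) * (A1 * F24 - A2 * F14 + A4 * F12)
    - (- c141 - c242 - c343) * (A1 * F23 - A2 * F13 + A3 * F12)
    - A1 * ((- c341 * F12 + c343 * F23 + c344 * F24) - (- c241 * F13 - c242 * F23 + c244 * F34)
        + (- c231 * F14 - c232 * F24 - c233 * F34))
    + A2 * ((c342 * F12 + c343 * F13 + c344 * F14) - (- c141 * F13 - c142 * F23 + c144 * F34)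
        + (- c131 * F14 - c132 * F24 - c133 * F34))
    - A3 * ((c242 * F12 + c243 * F13 + c244 * F14) - (- c141 * F12 + c143 * F23 + c144 * F24)
        + (- c121 * F14 - c122 * F24 - c123 * F34))
    + A4 * ((c232 * F12 + c233 * F13 + c234 * F14) - (- c131 * F12 + c133 * F23 + c134 * F24)
        + (- c121 * F13 - c122 * F23 + c124 * F34))"
  by (simp add: algebra_simps)

lemma std_structureD:
  assumes "std_structure br"
  shows "lie_algebra br" "bilinear br" "br x x = 0" "br (axis 5 1) x = 0" "br x (axis 5 1) = 0"
    and "br x y $ 5 = 2 * e2 1 2 x y + 2 * e2 3 4 x y"
    and "br x (br y z) + br y (br z x) + br z (br x y) = 0"
proof -
  have s: "sasakian br std_phi (axis 5 1) (\<lambda>x. x $ 5) inner"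
    and c: "\<And>x. br (axis 5 1) x = 0"
    using assms by (auto simp: std_structure_def sasakian_eta_einstein_def)
  show L': "lie_algebra br" "bilinear br" and a: "br x x = 0" for x
    using sasakian_lie_algebra[OF s] by (auto simp: lie_algebra_def)
  show "br (axis 5 1) x = 0" by (rule c)
  show "br x (axis 5 1) = 0" using alternating_antisym[OF L'(2) a] c by (metis neg_0_equal_iff_equal)
  show "br x y $ 5 = 2 * e2 1 2 x y + 2 * e2 3 4 x y"
    using d_eta[OF s, of x y] by (simp add: inner_5 std_phi_def vector_5 e2_def algebra_simps)
  show "br x (br y z) + br y (br z x) + br z (br x y) = 0"
    using sasakian_lie_algebra[OF s] by (simp add: lie_algebra_def)
qed

text \<open>Evaluating the Jacobi identity and the Einstein condition on frame vectors yields the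
  equations \<open>J\<close> and \<open>R\<close> of \<open>normal_parameters\<close>.\<close>

lemma std_structure_parameters:
  assumes "std_structure (normal_bracket a b1 b2 c1 c2 p q)"
  shows "a = 0 \<and> b1 = 0 \<and> b2 = 0 \<and> c1 = 0 \<and> c2 = 0 \<or>
    a \<noteq> 0 \<and> b1 = 0 \<and> b2 = 0 \<and>
      (c1 = a / 2 \<and> c2 = a / 2 \<and> q = a / 2 \<or> p = 0 \<and> q = a \<and> (c1 = 0 \<and> c2 = a \<or> c1 = a \<and> c2 = 0))"
proof (rule normal_parameters)
  let ?b = "normal_bracket a b1 b2 c1 c2 p q"
  have J: "(?b x (?b y z) + ?b y (?b z x) + ?b z (?b x y)) $ k = 0" for x y z k
    using std_structureD(7)[OF assms] by simp
  show "p * (c1 - c2) = 2 * b1 * b2"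
    using J[of "axis 1 1" "axis 2 1" "axis 3 1" 3]
    by (simp add: normal_bracket_def axis_5 vector_5 e2_def algebra_simps)
  show "a * (q - c1) - 2 * b2\<^sup>2 - c1\<^sup>2 + c1 * c2 + c1 * q - c2 * q = 0"
    using J[of "axis 1 1" "axis 2 1" "axis 3 1" 4]
    by (simp add: normal_bracket_def axis_5 vector_5 e2_def algebra_simps power2_eq_square)
  show "a * (c2 - q) + 2 * b1\<^sup>2 + c2\<^sup>2 - c1 * c2 + c1 * q - c2 * q = 0"
    using J[of "axis 1 1" "axis 2 1" "axis 4 1" 3]
    by (simp add: normal_bracket_def axis_5 vector_5 e2_def algebra_simps power2_eq_square)
  show "a * (c1 + c2) = 2 * b1\<^sup>2 + 2 * b2\<^sup>2 + (c1 + c2)\<^sup>2"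
    using J[of "axis 1 1" "axis 3 1" "axis 4 1" 2]
    by (simp add: normal_bracket_def axis_5 vector_5 e2_def algebra_simps power2_eq_square)
  obtain l m where R: "ricci ?b inner x y = l * (x \<bullet> y) + m * (x $ 5 * y $ 5)" for x y
    using assms by (auto simp: std_structure_def sasakian_eta_einstein_def eta_einstein_def)
  note r = R[unfolded ricci_normal[OF std_structureD(1)[OF assms]] inner_5]
  show "b1 * (a + q) = 0" "b2 * (a + q) = 0"
    using r[of "axis 1 1" "axis 4 1"] r[of "axis 1 1" "axis 3 1"] by (simp_all add: axis_5 vector_5)
  show "a * c1 + 2 * b2\<^sup>2 + c1\<^sup>2 + c1 * c2 + 2 * c2 * q = a\<^sup>2 + 2 * b1\<^sup>2 + 2 * b2\<^sup>2 + c1\<^sup>2 + c2\<^sup>2"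
    "a * c2 + 2 * b1\<^sup>2 + c2\<^sup>2 + c1 * c2 + 2 * c1 * q = a\<^sup>2 + 2 * b1\<^sup>2 + 2 * b2\<^sup>2 + c1\<^sup>2 + c2\<^sup>2"
    using r[of "axis 1 1" "axis 1 1"] r[of "axis 3 1" "axis 3 1"] r[of "axis 4 1" "axis 4 1"]
    by (simp_all add: axis_5 vector_5)
qed

lemma unimodular_closed_form:
  assumes S: "std_structure br" and T: "\<And>x. lin_trace (br x) = 0"
  obtains A where "A \<noteq> 0" "A $ 5 = 0" "\<And>x y. A \<bullet> br x y = 0"
proof -
  note D = std_structureD[OF S]
  define b where "b i j = br (axis i 1) (axis j 1)" for i j
  \<comment> \<open>For the form \<beta> dual to \<open>A\<close>, \<open>A \<bullet> b i j\<close>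
    is \<open>- d\<beta>(e\<^sub>i, e\<^sub>j)\<close>. Orthogonality to the first three vectors
    kills the self-dual part of \<open>d\<beta>\<close>, and the fourth makes \<open>A\<close>
    horizontal; four conditions in dimension five leave a nonzero \<open>A\<close>.\<close>
  let ?S = "{b 1 2 + b 3 4, b 1 3 - b 2 4, b 1 4 + b 2 3, axis 5 1}"
  have "card ?S \<le> 4"
    by (rule order_trans[OF card_insert_le_m1]) (auto intro!: card_insert_le_m1)
  then have "dim ?S < DIM(real^5)"
    using dim_le_card'[of ?S] by simp
  then obtain A where "A \<noteq> 0" and orth: "\<And>y. y \<in> span ?S \<Longrightarrow> orthogonal A y"
    by (rule orthogonal_to_subspace_exists) blast
  have A: "A \<bullet> y = 0" if "y \<in> ?S" for y
    using orth[OF span_base[OF that]] by (simp add: orthogonal_def)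
  have A5: "A $ 5 = 0" using A[of "axis 5 1"] by (simp add: inner_axis)
  define F where "F i j = A \<bullet> b i j" for i j
  have F: "F i j = A$1 * b i j $ 1 + A$2 * b i j $ 2 + A$3 * b i j $ 3 + A$4 * b i j $ 4" for i j
    by (simp add: F_def inner_5 A5)
  have sd: "F 3 4 = - F 1 2" "F 2 4 = F 1 3" "F 2 3 = - F 1 4"
    using A[of "b 1 2 + b 3 4"] A[of "b 1 3 - b 2 4"] A[of "b 1 4 + b 2 3"]
    by (simp_all add: F_def inner_add_right inner_diff_right)
  have anti: "b j i = - b i j" for i j
    unfolding b_def by (rule alternating_antisym[OF D(2,3)])
  have b0: "b i i = 0" "b i 5 = 0" for i by (simp_all add: b_def D)
  have swap: "b 2 1 = - b 1 2" "b 3 1 = - b 1 3" "b 4 1 = - b 1 4" "b 3 2 = - b 2 3"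
    "b 4 2 = - b 2 4" "b 4 3 = - b 3 4" by (rule anti)+
  have lin: "linear (\<lambda>v. A \<bullet> br x v)" for x
    using D(2) by (simp add: bilinear_def linear_iff inner_add_right)
  have ex: "A \<bullet> br (axis i 1) v = v$1 * F i 1 + v$2 * F i 2 + v$3 * F i 3 + v$4 * F i 4" for i v
    using linear_expand_5[OF lin, of "axis i 1" v] D(5) by (simp add: F_def b_def)
  have J: "A \<bullet> br (axis i 1) (b j k) + A \<bullet> br (axis j 1) (b k i) + A \<bullet> br (axis k 1) (b i j) = 0" for i j k
    using D(7)[of "axis i 1" "axis j 1" "axis k 1"]
    by (simp add: b_def flip: inner_add_right)
  have Fs: "F 2 1 = - F 1 2" "F 3 1 = - F 1 3" "F 4 1 = - F 1 4" "F 3 2 = - F 2 3"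
    "F 4 2 = - F 2 4" "F 4 3 = - F 3 4" "F i i = 0" for i
    by (simp_all add: F_def swap b0)
  have tr: "b i 1 $ 1 + b i 2 $ 2 + b i 3 $ 3 + b i 4 $ 4 = 0" for i
    using T[of "axis i 1"] lin_trace_5[of "br (axis i 1)"] D(2) D(5)[of "axis i 1"]
    by (simp add: b_def bilinear_def)
  \<comment> \<open>The four components of \<open>d(d\<beta>) = 0\<close>; they cancel the last four
    lines of \<open>wedge_differential_identity\<close>, and the traces \<open>tr'\<close> cancel
    the first four.\<close>
  have J': "(- b 3 4 $ 1 * F 1 2 + b 3 4 $ 3 * F 2 3 + b 3 4 $ 4 * F 2 4)
        - (- b 2 4 $ 1 * F 1 3 - b 2 4 $ 2 * F 2 3 + b 2 4 $ 4 * F 3 4)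
        + (- b 2 3 $ 1 * F 1 4 - b 2 3 $ 2 * F 2 4 - b 2 3 $ 3 * F 3 4) = 0"
      "(b 3 4 $ 2 * F 1 2 + b 3 4 $ 3 * F 1 3 + b 3 4 $ 4 * F 1 4)
        - (- b 1 4 $ 1 * F 1 3 - b 1 4 $ 2 * F 2 3 + b 1 4 $ 4 * F 3 4)
        + (- b 1 3 $ 1 * F 1 4 - b 1 3 $ 2 * F 2 4 - b 1 3 $ 3 * F 3 4) = 0"
      "(b 2 4 $ 2 * F 1 2 + b 2 4 $ 3 * F 1 3 + b 2 4 $ 4 * F 1 4)
        - (- b 1 4 $ 1 * F 1 2 + b 1 4 $ 3 * F 2 3 + b 1 4 $ 4 * F 2 4)
        + (- b 1 2 $ 1 * F 1 4 - b 1 2 $ 2 * F 2 4 - b 1 2 $ 3 * F 3 4) = 0"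
      "(b 2 3 $ 2 * F 1 2 + b 2 3 $ 3 * F 1 3 + b 2 3 $ 4 * F 1 4)
        - (- b 1 3 $ 1 * F 1 2 + b 1 3 $ 3 * F 2 3 + b 1 3 $ 4 * F 2 4)
        + (- b 1 2 $ 1 * F 1 3 - b 1 2 $ 2 * F 2 3 + b 1 2 $ 4 * F 3 4) = 0"
    using J[of 2 3 4] J[of 1 3 4] J[of 1 2 4] J[of 1 2 3]
    unfolding swap ex Fs vector_uminus_component by linarith+
  have tr': "b 1 2 $ 2 + b 1 3 $ 3 + b 1 4 $ 4 = 0" "- b 1 2 $ 1 + b 2 3 $ 3 + b 2 4 $ 4 = 0"
    "- b 1 3 $ 1 - b 2 3 $ 2 + b 3 4 $ 4 = 0" "- b 1 4 $ 1 - b 2 4 $ 2 - b 3 4 $ 3 = 0"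
    using tr[of 1] tr[of 2] tr[of 3] tr[of 4] unfolding swap b0 vector_uminus_component zero_index
    by linarith+
  \<comment> \<open>The identity with \<open>d\<beta>\<close> itself as the 2-form:
    \<open>F \<and> F = 0\<close>. For an anti-self-dual \<open>F\<close> this is minus a sum of
    squares.\<close>
  have "F 1 2 * F 3 4 + F 1 2 * F 3 4 - F 1 3 * F 2 4 - F 1 3 * F 2 4 + F 1 4 * F 2 3 + F 1 4 * F 2 3 = 0"
    using wedge_differential_identity[of "A$1" "b 1 2 $ 1" "A$2" "b 1 2 $ 2" "A$3" "b 1 2 $ 3" "A$4" "b 1 2 $ 4"
        "F 3 4" "F 1 2" "b 3 4 $ 1" "b 3 4 $ 2" "b 3 4 $ 3" "b 3 4 $ 4"
        "b 1 3 $ 1" "b 1 3 $ 2" "b 1 3 $ 3" "b 1 3 $ 4" "F 2 4"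
        "F 1 3" "b 2 4 $ 1" "b 2 4 $ 2" "b 2 4 $ 3" "b 2 4 $ 4"
        "b 1 4 $ 1" "b 1 4 $ 2" "b 1 4 $ 3" "b 1 4 $ 4" "F 2 3"
        "F 1 4" "b 2 3 $ 1" "b 2 3 $ 2" "b 2 3 $ 3" "b 2 3 $ 4"]
    unfolding F[symmetric] J' tr' by simp
  then have "(F 1 2)\<^sup>2 + (F 1 3)\<^sup>2 + (F 1 4)\<^sup>2 = 0"
    unfolding sd by (simp add: power2_eq_square)
  then have "(F 1 2)\<^sup>2 = 0" "(F 1 3)\<^sup>2 = 0" "(F 1 4)\<^sup>2 = 0"
    using zero_le_power2[of "F 1 2"] zero_le_power2[of "F 1 3"] zero_le_power2[of "F 1 4"] by linarith+
  then have "F 1 2 = 0" "F 1 3 = 0" "F 1 4 = 0" by simp_all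
  then have F0: "A \<bullet> b 1 2 = 0" "A \<bullet> b 1 3 = 0" "A \<bullet> b 1 4 = 0" "A \<bullet> b 2 3 = 0" "A \<bullet> b 2 4 = 0" "A \<bullet> b 3 4 = 0"
    using sd by (simp_all add: F_def)
  have "bilinear (\<lambda>x y. A \<bullet> br x y)"
    using D(2) by (simp add: bilinear_def linear_iff inner_add_right)
  then have "A \<bullet> br x y = 0" for x y
    using alternating_expand_5[of "\<lambda>x y. A \<bullet> br x y" x y] F0 D(3,5) by (simp add: b_def)
  with \<open>A \<noteq> 0\<close> A5 show thesis using that by blast
qed

lemma closed_form_exists:
  assumes S: "std_structure br"
  obtains A where "A \<bullet> A = 1" "A $ 5 = 0" "\<And>x y. A \<bullet> br x y = 0" "\<And>x. A \<bullet> x = 0 \<Longrightarrow> lin_trace (br x) = 0"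
proof -
  note D = std_structureD[OF S]
  have l: "linear (br x)" for x using D(2) by (simp add: bilinear_def)
  have lT: "linear (\<lambda>x. lin_trace (br x))"
    using D(2) by (intro linearI)
      (simp_all add: lin_trace_cart[OF l] bilinear_ladd bilinear_lmul sum.distrib sum_distrib_left)
  define H :: "real^5" where "H = (\<chi> i. lin_trace (br (axis i 1)))"
  have H: "H \<bullet> x = lin_trace (br x)" for x
    unfolding linear_expand_5[OF lT, of x] by (simp add: H_def inner_5)
  have H5: "H $ 5 = 0"
    by (simp add: H_def lin_trace_cart[OF l] D(4))
  obtain A where A: "A \<noteq> 0" "A $ 5 = 0" "\<And>x y. A \<bullet> br x y = 0" "\<And>x. A \<bullet> x = 0 \<Longrightarrow> lin_trace (br x) = 0"
  proof (cases "H = 0")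
    case True
    then have T: "lin_trace (br x) = 0" for x using H[of x] by simp
    show thesis
      by (rule unimodular_closed_form[OF S T]) (use that T in auto)
  next
    case False
    \<comment> \<open>The gradient \<open>H\<close> is closed because
      \<open>H \<bullet> [x, y] = tr ad [x, y] = 0\<close>.\<close>
    show thesis
      by (rule that[of H]) (use False H5 lin_trace_ad_bracket[OF D(1)] in \<open>auto simp: H\<close>)
  qed
  then show thesis
    by (intro that[of "A /\<^sub>R norm A"])
      (auto simp: inner_scaleR_left norm_eq_sqrt_inner field_simps simp flip: power2_eq_square)
qed

text \<open>The \<xi>-component of the Jacobi identity (closedness of the Kaehler form), normality
  on the first and third frame vectors, and the trace conditions are all linear in the structure
  constants. Together with \<open>c\<close> and \<open>diag\<close> they leave seven free
  numbers.\<close>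

lemma normal_form:
  assumes S: "std_structure br" and c: "\<And>x y. br x y $ 1 = 0"
    and t: "lin_trace (br (axis 3 1)) = 0" "lin_trace (br (axis 4 1)) = 0"
    and diag: "br (axis 1 1) (axis 3 1) $ 4 + br (axis 1 1) (axis 4 1) $ 3 = 0"
  shows "\<exists>a b1 b2 c1 c2 p q. br = normal_bracket a b1 b2 c1 c2 p q"
proof -
  note D = std_structureD[OF S]
  have N: "normality_tensor br std_phi (axis 5 1) (\<lambda>x. x $ 5) x y = 0" for x y
    using S by (auto simp: std_structure_def sasakian_eta_einstein_def sasakian_def)
  define b where "b i j = br (axis i 1) (axis j 1)" for i j
  have anti: "b j i = - b i j" for i j
    unfolding b_def by (rule alternating_antisym[OF D(2,3)])
  have b0: "b i i = 0" "b i 5 = 0" for i by (simp_all add: b_def D)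
  have swap: "b 2 1 = - b 1 2" "b 3 1 = - b 1 3" "b 4 1 = - b 1 4" "b 3 2 = - b 2 3"
    "b 4 2 = - b 2 4" "b 4 3 = - b 3 4" by (rule anti)+
  have b_1: "b i j $ 1 = 0" for i j by (simp add: b_def c)
  have b5: "b 1 2 $ 5 = 2" "b 1 3 $ 5 = 0" "b 1 4 $ 5 = 0" "b 2 3 $ 5 = 0" "b 2 4 $ 5 = 0" "b 3 4 $ 5 = 2"
    by (simp_all add: b_def D(6) e2_def axis_def)
  have J: "(br (axis i 1) (b j k) + br (axis j 1) (b k i) + br (axis k 1) (b i j)) $ 5 = 0" for i j k
    using D(7)[of "axis i 1" "axis j 1" "axis k 1"] by (simp add: b_def)
  have J5: "b 2 3 $ 2 = - b 1 2 $ 4" "b 2 4 $ 2 = b 1 2 $ 3" "b 1 3 $ 3 + b 1 4 $ 4 = b 3 4 $ 2"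
    "b 2 3 $ 3 + b 2 4 $ 4 = 0"
    using J[of 1 2 3] J[of 1 2 4] J[of 1 3 4] J[of 2 3 4] unfolding swap
    by (simp_all add: D(6) e2_def axis_def b_1)
  have tr: "b 2 3 $ 2 = b 3 4 $ 4" "b 2 4 $ 2 = - b 3 4 $ 3"
    using t lin_trace_5[of "br (axis 3 1)"] lin_trace_5[of "br (axis 4 1)"] D(2) D(5)
      swap b_1 b0(1)
    by (simp_all add: b_def bilinear_def)
  have phi: "std_phi (axis 1 1) = axis 2 1" "std_phi (axis 3 1) = axis 4 1" "std_phi (axis 4 1) = - axis 3 1"
    by (simp_all add: std_phi_def vec_eq_iff forall_5 vector_5 axis_5)
  have N13: "(b 2 4 + std_phi (std_phi (b 1 3)) - std_phi (b 1 4) - std_phi (b 2 3)) $ k = 0" for k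
    using N[of "axis 1 1" "axis 3 1"] b5 by (simp add: normality_tensor_def ce_d_def phi b_def)
  have n: "b 1 4 $ 2 = - b 2 3 $ 2" "b 1 3 $ 2 = b 2 4 $ 2" "b 2 4 $ 3 = b 1 3 $ 3 - b 1 4 $ 4 - b 2 3 $ 4"
    "b 2 4 $ 4 = b 1 3 $ 4 + b 1 4 $ 3 + b 2 3 $ 3"
    using N13[of 1] N13[of 2] N13[of 3] N13[of 4] by (simp_all add: std_phi_def vector_5 b_1)
  \<comment> \<open>\<open>diag\<close> turns \<open>n(4)\<close> into equality of
    \<open>b 2 3 $ 3\<close> and \<open>b 2 4 $ 4\<close>, while \<open>J5(4)\<close> makes their
    sum zero.\<close>
  have z: "b 2 3 $ 3 = 0" "b 2 4 $ 4 = 0" "b 1 4 $ 3 = - b 1 3 $ 4"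
    using n(4) J5(4) diag by (simp_all add: b_def)
  \<comment> \<open>Read off from \<open>[X, Y] = \<nabla>\<^sub>X Y - \<nabla>\<^sub>Y X\<close>.
    The \<open>f\<close>-component of \<open>[B, e]\<close> is \<open>q - c1\<close>, hence the
    correction in \<open>q\<close>.\<close>
  define a b1 b2 c1 c2 p q where params: "a = - b 1 2 $ 2" "b1 = - b 1 2 $ 3" "b2 = - b 1 2 $ 4" "c1 = - b 1 3 $ 3"
    "c2 = - b 1 4 $ 4" "p = b 1 3 $ 4" "q = b 2 3 $ 4 - b 1 3 $ 3"
  have "br x y = normal_bracket a b1 b2 c1 c2 p q x y" for x y
  proof -
    have lk: "bilinear (\<lambda>x y. br x y $ k)" for k
      using D(2) by (simp add: bilinear_def linear_iff)
    have "br x y $ k = e2 1 2 x y * b 1 2 $ k + e2 1 3 x y * b 1 3 $ k + e2 1 4 x y * b 1 4 $ k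
        + e2 2 3 x y * b 2 3 $ k + e2 2 4 x y * b 2 4 $ k + e2 3 4 x y * b 3 4 $ k" for k
      using alternating_expand_5[OF lk, of k x y] by (simp add: D(3,5) b_def)
    moreover have "b 3 4 $ 2 = b 1 3 $ 3 + b 1 4 $ 4" "b 3 4 $ 3 = - b 1 2 $ 3" "b 3 4 $ 4 = - b 1 2 $ 4"
      "b 1 3 $ 2 = b 1 2 $ 3" "b 1 4 $ 2 = b 1 2 $ 4"
      using tr J5 n by simp_all
    ultimately show ?thesis
      by (simp add: vec_eq_iff forall_5 normal_bracket_def vector_5 params b_1 b5 J5(1,2) n(3) z algebra_simps)
  qed
  then show ?thesis by (intro exI ext)
qed

section \<open>Classification\<close>

lemma std_structure_normal_form:
  assumes S: "std_structure br"
  obtains a b1 b2 c1 c2 p q where "std_structure (normal_bracket a b1 b2 c1 c2 p q)"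
    "normal_bracket a b1 b2 c1 c2 p q \<simeq>\<^sub>L br"
proof -
  have s: "sasakian br std_phi (axis 5 1) (\<lambda>x. x $ 5) inner"
    and L: "lie_algebra br" and E: "eta_einstein br (\<lambda>x. x $ 5) inner"
    using S std_structureD(1) by (auto simp: std_structure_def sasakian_eta_einstein_def)
  obtain A where A: "A \<bullet> A = 1" "A $ 5 = 0" "\<And>x y. A \<bullet> br x y = 0" "\<And>x. A \<bullet> x = 0 \<Longrightarrow> lin_trace (br x) = 0"
    using closed_form_exists[OF S] by blast
  obtain e where e: "e \<bullet> e = 1" "e $ 5 = 0" "e \<bullet> A = 0" "e \<bullet> std_phi A = 0"
    and diag: "br A e \<bullet> std_phi e + br A (std_phi e) \<bullet> e = 0"
    using diagonalizing_frame[OF s dim_real5 A(1,2)] by blast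
  let ?F = "frame std_phi (axis 5 1) A e"
  note lin = linear_frame[OF s, of A e] and bij = bij_frame[OF s dim_real5 A(1,2) e]
    and iso = frame_isometry[OF s A(1,2) e]
  obtain br' where S': "std_structure br'" and hom: "\<And>x y. ?F (br' x y) = br (?F x) (?F y)"
    using frame_std_structure[OF s dim_real5 E std_structureD(4)[OF S] A(1,2) e] by blast
  have comp: "br' x y $ i = br (?F x) (?F y) \<bullet> ?F (axis i 1)" for x y i
    using iso(1)[of "br' x y" "axis i 1"] by (simp add: hom inner_axis)
  have tr: "lin_trace (br' x) = lin_trace (br (?F x))" for x
    by (rule lin_trace_conj[OF _ _ lin bij])
      (use L std_structureD(1)[OF S'] in \<open>simp_all add: linear_ad hom\<close>)
  have "A \<bullet> std_phi e = 0" using g_phi_skew[OF s, of e A] e by (simp add: inner_commute)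
  then have t: "lin_trace (br' (axis 3 1)) = 0" "lin_trace (br' (axis 4 1)) = 0"
    using A(4) e(3) by (simp_all add: tr frame_axis[OF s] inner_commute)
  have "br' x y $ 1 = 0" for x y
    using A(3) by (simp add: comp frame_axis[OF s] inner_commute)
  moreover have "br' (axis 1 1) (axis 3 1) $ 4 + br' (axis 1 1) (axis 4 1) $ 3 = 0"
    using diag by (simp add: comp frame_axis[OF s])
  ultimately obtain a b1 b2 c1 c2 p q where n: "br' = normal_bracket a b1 b2 c1 c2 p q"
    using normal_form[OF S' _ t] by blast
  have "br' \<simeq>\<^sub>L br"
    unfolding lie_isomorphic_def using lin bij hom by blast
  with S' show thesis unfolding n by (rule that)
qed

lemma std_structure_classification:
  assumes "std_structure br"
  shows "br \<simeq>\<^sub>L \<gg>\<^sub>1 \<or> br \<simeq>\<^sub>L \<gg>\<^sub>3 \<or> br \<simeq>\<^sub>L \<gg>\<^sub>4 \<or> br \<simeq>\<^sub>L \<gg>\<^sub>5 \<or> (\<exists>\<delta>>0. br \<simeq>\<^sub>L \<gg>\<^sub>7 \<delta>)"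
  by (rule std_structure_normal_form[OF assms]) (rule normal_bracket_models[OF std_structure_parameters])

text \<open>Any horizontal unit vector serves for this first frame, which only moves the structure
  to \<open>real^5\<close>, where traces are coordinate sums. The distinguished closed direction is
  found there, and \<open>std_structure_normal_form\<close> changes the frame a second time.\<close>

lemma sasakian_classification:
  fixes br :: "'a::real_vector \<Rightarrow> 'a \<Rightarrow> 'a"
  assumes dim: "dim (UNIV :: 'a set) = 5" and center: "lie_center br \<noteq> {0}"
    and S: "sasakian br \<phi> \<xi> \<eta> g" and E: "eta_einstein br \<eta> g"
  shows "br \<simeq>\<^sub>L \<gg>\<^sub>1 \<or> br \<simeq>\<^sub>L \<gg>\<^sub>3 \<or> br \<simeq>\<^sub>L \<gg>\<^sub>4 \<or> br \<simeq>\<^sub>L \<gg>\<^sub>5 \<or> (\<exists>\<delta>>0. br \<simeq>\<^sub>L \<gg>\<^sub>7 \<delta>)"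
proof -
  have "\<exists>v. g v v = 1 \<and> (\<forall>u\<in>{\<xi>}. g v u = 0)"
    by (rule unit_orthogonal_exists[OF S]) (use dim in \<open>auto simp: g_xi[OF S] eta_xi[OF S]\<close>)
  then obtain A where A: "g A A = 1" "\<eta> A = 0" by (auto simp: g_xi[OF S])
  obtain e where e: "g e e = 1" "\<eta> e = 0" "g e A = 0" "g e (\<phi> A) = 0"
    using diagonalizing_frame[OF S dim A] by blast
  obtain br' where "std_structure br'"
    and hom: "\<And>x y. frame \<phi> \<xi> A e (br' x y) = br (frame \<phi> \<xi> A e x) (frame \<phi> \<xi> A e y)"
    using frame_std_structure[OF S dim E center_xi[OF S center] A e] by blast
  have "br' \<simeq>\<^sub>L br"
    unfolding lie_isomorphic_def using linear_frame[OF S] bij_frame[OF S dim A e] hom by blast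
  then show ?thesis
    using std_structure_classification[OF \<open>std_structure br'\<close>] lie_isomorphic_sym lie_isomorphic_trans by meson
qed

lemma sasakian_eta_einstein_iff:
  fixes br :: "'a::real_vector \<Rightarrow> 'a \<Rightarrow> 'a"
  shows "(lie_algebra br \<and> dim (UNIV :: 'a set) = 5 \<and> lie_center br \<noteq> {0} \<and>
      (\<exists>\<phi> \<xi> \<eta> g. sasakian br \<phi> \<xi> \<eta> g \<and> eta_einstein br \<eta> g))
    \<longleftrightarrow> br \<simeq>\<^sub>L \<gg>\<^sub>1 \<or> br \<simeq>\<^sub>L \<gg>\<^sub>3 \<or> br \<simeq>\<^sub>L \<gg>\<^sub>4 \<or> br \<simeq>\<^sub>L \<gg>\<^sub>5 \<or> (\<exists>\<delta>>0. br \<simeq>\<^sub>L \<gg>\<^sub>7 \<delta>)"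
  by (rule iffI, elim exE conjE, rule sasakian_classification, assumption+)
    (rule sasakian_eta_einstein_exists)

section \<open>Models and invariants\<close>

text \<open>An isomorphism \<open>f\<close> conjugates \<open>ad x\<close> into
  \<open>ad (f x)\<close>; here \<open>x\<close> is the preimage of \<open>z\<close>.\<close>

lemma lie_isomorphic_traces:
  fixes br br' :: "real^5 \<Rightarrow> real^5 \<Rightarrow> real^5"
  assumes "br \<simeq>\<^sub>L br'" "lie_algebra br" "lie_algebra br'"
  shows "\<exists>x. lin_trace (br' z) = lin_trace (br x) \<and>
    lin_trace (\<lambda>y. br' z (br' z y)) = lin_trace (\<lambda>y. br x (br x y))"
proof -
  obtain f where f: "linear f" "bij f" "\<And>x y. f (br x y) = br' (f x) (f y)"
    using assms(1) unfolding lie_isomorphic_def by blast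
  obtain x where z: "z = f x" using f(2) by (meson bij_pointE)
  have "lin_trace (br x) = lin_trace (br' z)"
    by (rule lin_trace_conj[OF _ _ f(1,2)]) (use assms in \<open>simp_all add: linear_ad f z\<close>)
  moreover have "lin_trace (\<lambda>y. br x (br x y)) = lin_trace (\<lambda>y. br' z (br' z y))"
    by (rule lin_trace_conj[OF _ _ f(1,2)]) (use assms in \<open>simp_all add: linear_ad f z\<close>)
  ultimately show ?thesis by metis
qed

lemmas trace_simps = vector_5 e2_def axis_5

lemma lin_trace_ad_g1: "lin_trace (\<gg>\<^sub>1 x) = 0" "lin_trace (\<lambda>y. \<gg>\<^sub>1 x (\<gg>\<^sub>1 x y)) = 0"
  unfolding lin_trace_5[OF linear_ad(1)[OF lie_algebra_g1]] lin_trace_5[OF linear_ad(2)[OF lie_algebra_g1]]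
  by (simp_all add: trace_simps \<gg>\<^sub>1_def)

lemma lin_trace_ad_g3: "lin_trace (\<gg>\<^sub>3 x) = 0" "lin_trace (\<lambda>y. \<gg>\<^sub>3 x (\<gg>\<^sub>3 x y)) = - 2 * (x $ 1)\<^sup>2"
  unfolding lin_trace_5[OF linear_ad(1)[OF lie_algebra_g3]] lin_trace_5[OF linear_ad(2)[OF lie_algebra_g3]]
  by (simp_all add: trace_simps \<gg>\<^sub>3_def power2_eq_square)

lemma lin_trace_ad_g4:
  "lin_trace (\<gg>\<^sub>4 x) = x $ 1 + x $ 3" "lin_trace (\<lambda>y. \<gg>\<^sub>4 x (\<gg>\<^sub>4 x y)) = (x $ 1)\<^sup>2 + (x $ 3)\<^sup>2"
  unfolding lin_trace_5[OF linear_ad(1)[OF lie_algebra_g4]] lin_trace_5[OF linear_ad(2)[OF lie_algebra_g4]]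
  by (simp_all add: trace_simps \<gg>\<^sub>4_def power2_eq_square)

lemma lin_trace_ad_g5:
  "lin_trace (\<gg>\<^sub>5 x) = 2 * x $ 4" "lin_trace (\<lambda>y. \<gg>\<^sub>5 x (\<gg>\<^sub>5 x y)) = 3 / 2 * (x $ 4)\<^sup>2"
  unfolding lin_trace_5[OF linear_ad(1)[OF lie_algebra_g5]] lin_trace_5[OF linear_ad(2)[OF lie_algebra_g5]]
  by (simp_all add: trace_simps \<gg>\<^sub>5_def power2_eq_square)

lemma lin_trace_ad_g7:
  "lin_trace (\<gg>\<^sub>7 \<delta> x) = 2 * \<delta> * x $ 4"
  "lin_trace (\<lambda>y. \<gg>\<^sub>7 \<delta> x (\<gg>\<^sub>7 \<delta> x y)) = (3 / 2 * \<delta>\<^sup>2 - 2) * (x $ 4)\<^sup>2"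
  unfolding lin_trace_5[OF linear_ad(1)[OF lie_algebra_g7]] lin_trace_5[OF linear_ad(2)[OF lie_algebra_g7]]
  by (simp_all add: trace_simps \<gg>\<^sub>7_def power2_eq_square algebra_simps)

lemma g7_isomorphic_imp_eq:
  "\<forall>\<delta>>0. \<forall>\<delta>'>0. \<gg>\<^sub>7 \<delta> \<simeq>\<^sub>L \<gg>\<^sub>7 \<delta>' \<longrightarrow> \<delta> = \<delta>'"
proof (intro allI impI)
  fix \<delta> \<delta>' :: real
  assume pos: "\<delta> > 0" "\<delta>' > 0" and iso: "\<gg>\<^sub>7 \<delta> \<simeq>\<^sub>L \<gg>\<^sub>7 \<delta>'"
  obtain x :: "real^5" where
    "\<delta> * x $ 4 = \<delta>'" and *: "(3 / 2 * \<delta>'\<^sup>2 - 2) = (3 / 2 * \<delta>\<^sup>2 - 2) * (x $ 4)\<^sup>2"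
    using lie_isomorphic_traces[OF _ lie_algebra_g7 lie_algebra_g7, of \<delta> \<delta>' "axis 4 1"] iso
    by (auto simp: lin_trace_ad_g7)
  moreover from this(1) have "\<delta>\<^sup>2 * (x $ 4)\<^sup>2 = \<delta>'\<^sup>2" by (auto simp: power_mult_distrib)
  \<comment> \<open>The terms with the squared parameters cancel in \<open>*\<close>, leaving
    \<open>- 2\<close> equal to \<open>- 2 * (x $ 4)\<^sup>2\<close>; positivity of the parameters
    fixes the sign.\<close>
  ultimately have "(x $ 4)\<^sup>2 = 1" "x $ 4 > 0"
    using pos by (auto simp: algebra_simps zero_less_mult_iff)
  then have "x $ 4 = 1" by (auto simp: power2_eq_1_iff)
  with \<open>\<delta> * x $ 4 = \<delta>'\<close> show "\<delta> = \<delta>'" by simp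
qed

text \<open>\<open>\<gg>\<^sub>1\<close> and \<open>\<gg>\<^sub>3\<close> are unimodular, the others
  are not; within each group \<open>tr (ad x)\<^sup>2\<close> decides.\<close>

lemma algebras_not_isomorphic:
  "\<not> \<gg>\<^sub>1 \<simeq>\<^sub>L \<gg>\<^sub>3 \<and> \<not> \<gg>\<^sub>1 \<simeq>\<^sub>L \<gg>\<^sub>4 \<and> \<not> \<gg>\<^sub>1 \<simeq>\<^sub>L \<gg>\<^sub>5
    \<and> \<not> \<gg>\<^sub>3 \<simeq>\<^sub>L \<gg>\<^sub>4 \<and> \<not> \<gg>\<^sub>3 \<simeq>\<^sub>L \<gg>\<^sub>5 \<and> \<not> \<gg>\<^sub>4 \<simeq>\<^sub>L \<gg>\<^sub>5
    \<and> (\<forall>\<delta>>0. \<not> \<gg>\<^sub>1 \<simeq>\<^sub>L \<gg>\<^sub>7 \<delta> \<and> \<not> \<gg>\<^sub>3 \<simeq>\<^sub>L \<gg>\<^sub>7 \<delta> \<and> \<not> \<gg>\<^sub>4 \<simeq>\<^sub>L \<gg>\<^sub>7 \<delta> \<and> \<not> \<gg>\<^sub>5 \<simeq>\<^sub>L \<gg>\<^sub>7 \<delta>)"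
proof (intro conjI allI impI)
  show "\<not> \<gg>\<^sub>1 \<simeq>\<^sub>L \<gg>\<^sub>3"
    using lie_isomorphic_traces[OF _ lie_algebra_g1 lie_algebra_g3, of "axis 1 1"]
    by (auto simp: lin_trace_ad_g1 lin_trace_ad_g3)
  show "\<not> \<gg>\<^sub>1 \<simeq>\<^sub>L \<gg>\<^sub>4" "\<not> \<gg>\<^sub>3 \<simeq>\<^sub>L \<gg>\<^sub>4"
    using lie_isomorphic_traces[OF _ lie_algebra_g1 lie_algebra_g4, of "axis 1 1"]
      lie_isomorphic_traces[OF _ lie_algebra_g3 lie_algebra_g4, of "axis 1 1"]
    by (auto simp: lin_trace_ad_g1 lin_trace_ad_g3 lin_trace_ad_g4 axis_def)
  show "\<not> \<gg>\<^sub>1 \<simeq>\<^sub>L \<gg>\<^sub>5" "\<not> \<gg>\<^sub>3 \<simeq>\<^sub>L \<gg>\<^sub>5"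
    using lie_isomorphic_traces[OF _ lie_algebra_g1 lie_algebra_g5, of "axis 4 1"]
      lie_isomorphic_traces[OF _ lie_algebra_g3 lie_algebra_g5, of "axis 4 1"]
    by (auto simp: lin_trace_ad_g1 lin_trace_ad_g3 lin_trace_ad_g5)
  \<comment> \<open>The element \<open>e\<^sub>1 - e\<^sub>3\<close> of \<open>\<gg>\<^sub>4\<close>
    has traces \<open>0\<close> and \<open>2\<close>, while in \<open>\<gg>\<^sub>5\<close> a zero
    first trace forces a zero second one. The isomorphism is reversed because the test element lies
    in the target.\<close>
  show "\<not> \<gg>\<^sub>4 \<simeq>\<^sub>L \<gg>\<^sub>5"
    using lie_isomorphic_sym[of \<gg>\<^sub>4 \<gg>\<^sub>5]
      lie_isomorphic_traces[OF _ lie_algebra_g5 lie_algebra_g4, of "axis 1 1 - axis 3 1"]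
    by (auto simp: lin_trace_ad_g4 lin_trace_ad_g5 axis_def)
next
  fix \<delta> :: real
  assume "\<delta> > 0"
  show "\<not> \<gg>\<^sub>1 \<simeq>\<^sub>L \<gg>\<^sub>7 \<delta>" "\<not> \<gg>\<^sub>3 \<simeq>\<^sub>L \<gg>\<^sub>7 \<delta>"
    using lie_isomorphic_traces[OF _ lie_algebra_g1 lie_algebra_g7, of \<delta> "axis 4 1"]
      lie_isomorphic_traces[OF _ lie_algebra_g3 lie_algebra_g7, of \<delta> "axis 4 1"] \<open>\<delta> > 0\<close>
    by (auto simp: lin_trace_ad_g1 lin_trace_ad_g3 lin_trace_ad_g7)
  show "\<not> \<gg>\<^sub>4 \<simeq>\<^sub>L \<gg>\<^sub>7 \<delta>"
    using lie_isomorphic_sym[of \<gg>\<^sub>4 "\<gg>\<^sub>7 \<delta>"]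
      lie_isomorphic_traces[OF _ lie_algebra_g7 lie_algebra_g4, of \<delta> "axis 1 1 - axis 3 1"] \<open>\<delta> > 0\<close>
    by (auto simp: lin_trace_ad_g4 lin_trace_ad_g7 axis_def)
  \<comment> \<open>Equal first traces force \<open>x $ 4 = \<delta>\<close>, and then the second
    traces differ by \<open>2\<close>.\<close>
  show "\<not> \<gg>\<^sub>5 \<simeq>\<^sub>L \<gg>\<^sub>7 \<delta>"
    using lie_isomorphic_traces[OF _ lie_algebra_g5 lie_algebra_g7, of \<delta> "axis 4 1"]
    by (auto simp: lin_trace_ad_g5 lin_trace_ad_g7)
qed

section \<open>Identification with the named Lie algebras\<close>

lemma g1_heisenberg: "\<gg>\<^sub>1 \<simeq>\<^sub>L \<hh>\<^sub>5"
  by (rule lie_isomorphicI[where f = "\<lambda>x. (vector [x$1, x$3], vector [x$2, x$4], - x$5)"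
        and f' = "\<lambda>(u, v, t). vector [u$1, v$1, u$2, v$2, - t]"])
    (auto simp: linear_iff vec_eq_iff forall_5 forall_2 vector_5 e2_def \<gg>\<^sub>1_def heisenberg_def
      inner_vec_def sum_2 algebra_simps)

lemmas product_simps = derivation_def prod_lie_def semidirect_R_def heisenberg_def abelian_lie_def
  aff_R_def linear_iff vec_eq_iff forall_5 vector_5 e2_def

text \<open>\<open>D\<close> is \<open>ad e\<^sub>1\<close> on the ideal spanned by the other basis
  vectors: a rotation in the Heisenberg factor, with the line factor sent into its center.\<close>

lemma g3_semidirect:
  "\<exists>D. derivation (prod_lie \<hh>\<^sub>3 lie_R) D \<and> \<gg>\<^sub>3 \<simeq>\<^sub>L semidirect_R D (prod_lie \<hh>\<^sub>3 lie_R)"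
proof (intro exI conjI)
  let ?D = "\<lambda>((u, v, t), s). ((v, - u, s), 0) :: (real \<times> real \<times> real) \<times> real"
  show "derivation (prod_lie \<hh>\<^sub>3 lie_R) ?D"
    by (auto simp: product_simps algebra_simps)
  show "\<gg>\<^sub>3 \<simeq>\<^sub>L semidirect_R ?D (prod_lie \<hh>\<^sub>3 lie_R)"
    by (rule lie_isomorphicI[where f = "\<lambda>x. (x$1, (x$2, x$3, - x$5), x$4)"
          and f' = "\<lambda>(r, (u, v, t), s). vector [r, u, v, s, - t]"])
      (auto simp: product_simps \<gg>\<^sub>3_def algebra_simps)
qed

text \<open>The form \<open>e\<^sup>2 + e\<^sup>4 + e\<^sup>5\<close> is closed, so its kernel is an
  ideal complementary to the central line of \<open>e\<^sub>5\<close>; it supplies the last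
  coordinate.\<close>

lemma g4_product: "\<gg>\<^sub>4 \<simeq>\<^sub>L prod_lie (prod_lie aff_R aff_R) lie_R"
  by (rule lie_isomorphicI[where f = "\<lambda>x. (((x$1, x$2), x$3, x$4), x$5 + x$2 + x$4)"
        and f' = "\<lambda>(((r, s), t, u), v). vector [r, s, t, u, v - s - u]"])
    (auto simp: product_simps \<gg>\<^sub>4_def algebra_simps)

text \<open>The closed form \<open>e\<^sup>3 + e\<^sup>5\<close> splits off the central line of
  \<open>e\<^sub>5\<close>; on its kernel \<open>D\<close> is \<open>ad e\<^sub>4\<close>.\<close>

lemma g5_product: "\<exists>D. derivation \<hh>\<^sub>3 D \<and> \<gg>\<^sub>5 \<simeq>\<^sub>L prod_lie lie_R (semidirect_R D \<hh>\<^sub>3)"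
proof (intro exI conjI)
  let ?D = "\<lambda>(u, v, t). (u / 2, v / 2, t) :: real \<times> real \<times> real"
  show "derivation \<hh>\<^sub>3 ?D"
    by (auto simp: product_simps field_simps)
  show "\<gg>\<^sub>5 \<simeq>\<^sub>L prod_lie lie_R (semidirect_R ?D \<hh>\<^sub>3)"
    by (rule lie_isomorphicI[where f = "\<lambda>x. (x$3 + x$5, x$4, x$1, x$2, x$3)"
          and f' = "\<lambda>(z, s, u, v, t). vector [u, v, t, s, z - t]"])
      (auto simp: product_simps \<gg>\<^sub>5_def field_simps)
qed

text \<open>The same splitting as for \<open>\<gg>\<^sub>5\<close>; now \<open>ad e\<^sub>4\<close>
  also rotates the Heisenberg plane.\<close>

lemma g7_product: "\<exists>D. derivation \<hh>\<^sub>3 D \<and> \<gg>\<^sub>7 \<delta> \<simeq>\<^sub>L prod_lie lie_R (semidirect_R D \<hh>\<^sub>3)"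
proof (intro exI conjI)
  let ?D = "\<lambda>(u, v, t). (\<delta> / 2 * u + v, - u + \<delta> / 2 * v, \<delta> * t) :: real \<times> real \<times> real"
  show "derivation \<hh>\<^sub>3 ?D"
    by (auto simp: product_simps field_simps)
  show "\<gg>\<^sub>7 \<delta> \<simeq>\<^sub>L prod_lie lie_R (semidirect_R ?D \<hh>\<^sub>3)"
    by (rule lie_isomorphicI[where f = "\<lambda>x. (x$3 + x$5, x$4, x$1, x$2, x$3)"
          and f' = "\<lambda>(z, s, u, v, t). vector [u, v, t, s, z - t]"])
      (auto simp: product_simps \<gg>\<^sub>7_def field_simps)
qed

lemma algebra_models:
  "\<gg>\<^sub>1 \<simeq>\<^sub>L \<hh>\<^sub>5
    \<and> (\<exists>D. derivation (prod_lie \<hh>\<^sub>3 lie_R) D \<and> \<gg>\<^sub>3 \<simeq>\<^sub>L semidirect_R D (prod_lie \<hh>\<^sub>3 lie_R))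
    \<and> \<gg>\<^sub>4 \<simeq>\<^sub>L prod_lie (prod_lie aff_R aff_R) lie_R
    \<and> (\<exists>D. derivation \<hh>\<^sub>3 D \<and> \<gg>\<^sub>5 \<simeq>\<^sub>L prod_lie lie_R (semidirect_R D \<hh>\<^sub>3))
    \<and> (\<forall>\<delta>>0. \<exists>D. derivation \<hh>\<^sub>3 D \<and> \<gg>\<^sub>7 \<delta> \<simeq>\<^sub>L prod_lie lie_R (semidirect_R D \<hh>\<^sub>3))"
  by (intro conjI allI impI g1_heisenberg g3_semidirect g4_product g5_product g7_product)

theorem theorem4p5:
  fixes br :: "'a::real_vector \<Rightarrow> 'a \<Rightarrow> 'a"
  shows
    "((lie_algebra br \<and> dim (UNIV :: 'a set) = 5 \<and> lie_center br \<noteq> {0} \<and>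
       (\<exists>\<phi> \<xi> \<eta> g. sasakian br \<phi> \<xi> \<eta> g \<and> eta_einstein br \<eta> g))
      \<longleftrightarrow> br \<simeq>\<^sub>L \<gg>\<^sub>1 \<or> br \<simeq>\<^sub>L \<gg>\<^sub>3 \<or> br \<simeq>\<^sub>L \<gg>\<^sub>4 \<or> br \<simeq>\<^sub>L \<gg>\<^sub>5 \<or> (\<exists>\<delta>>0. br \<simeq>\<^sub>L \<gg>\<^sub>7 \<delta>))
     \<and> \<gg>\<^sub>1 \<simeq>\<^sub>L \<hh>\<^sub>5
     \<and> (\<exists>D. derivation (prod_lie \<hh>\<^sub>3 lie_R) D \<and> \<gg>\<^sub>3 \<simeq>\<^sub>L semidirect_R D (prod_lie \<hh>\<^sub>3 lie_R))
     \<and> \<gg>\<^sub>4 \<simeq>\<^sub>L prod_lie (prod_lie aff_R aff_R) lie_R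
     \<and> (\<exists>D. derivation \<hh>\<^sub>3 D \<and> \<gg>\<^sub>5 \<simeq>\<^sub>L prod_lie lie_R (semidirect_R D \<hh>\<^sub>3))
     \<and> (\<forall>\<delta>>0. \<exists>D. derivation \<hh>\<^sub>3 D \<and> \<gg>\<^sub>7 \<delta> \<simeq>\<^sub>L prod_lie lie_R (semidirect_R D \<hh>\<^sub>3))
     \<and> \<not> \<gg>\<^sub>1 \<simeq>\<^sub>L \<gg>\<^sub>3 \<and> \<not> \<gg>\<^sub>1 \<simeq>\<^sub>L \<gg>\<^sub>4 \<and> \<not> \<gg>\<^sub>1 \<simeq>\<^sub>L \<gg>\<^sub>5
     \<and> \<not> \<gg>\<^sub>3 \<simeq>\<^sub>L \<gg>\<^sub>4 \<and> \<not> \<gg>\<^sub>3 \<simeq>\<^sub>L \<gg>\<^sub>5 \<and> \<not> \<gg>\<^sub>4 \<simeq>\<^sub>L \<gg>\<^sub>5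
     \<and> (\<forall>\<delta>>0. \<not> \<gg>\<^sub>1 \<simeq>\<^sub>L \<gg>\<^sub>7 \<delta> \<and> \<not> \<gg>\<^sub>3 \<simeq>\<^sub>L \<gg>\<^sub>7 \<delta> \<and> \<not> \<gg>\<^sub>4 \<simeq>\<^sub>L \<gg>\<^sub>7 \<delta> \<and> \<not> \<gg>\<^sub>5 \<simeq>\<^sub>L \<gg>\<^sub>7 \<delta>)
     \<and> (\<forall>\<delta>>0. \<forall>\<delta>'>0. \<gg>\<^sub>7 \<delta> \<simeq>\<^sub>L \<gg>\<^sub>7 \<delta>' \<longrightarrow> \<delta> = \<delta>')"
  by (insert sasakian_eta_einstein_iff[of br] algebra_models algebras_not_isomorphic
      g7_isomorphic_imp_eq, elim conjE, intro conjI) assumption+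

end
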